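(* Let $p\in\mathbb P_{\mathbb K}V$ be nonisotropic and let $t_1,t_2,s\in T_p\mathbb P_{\mathbb K}V$. Then the curvature tensor $R$ of the Levi-Civita connection $\nabla$ of the metric on $\mathbb P_{\mathbb K}V\setminus SV$, with the sign convention $R(T_1,T_2)S:=\nabla_{T_2}\nabla_{T_1}S-\nabla_{T_1}\nabla_{T_2}S+\nabla_{[T_1,T_2]}S$, is given at $p$ by $$R(t_1,t_2)s=st_1^*t_2+t_2t_1^*s-st_2^*t_1-t_1t_2^*s.$$
   Context: $\mathbb K$ is $\mathbb R$, $\mathbb C$ or $\mathbb H$ (quaternions). $V$ is a finite-dimensional right $\mathbb K$-vector space with a nondegenerate hermitian form $\langle-,-\rangle$: it takes values in $\mathbb K$, is biadditive, and satisfies $\langle v_1k,v_2\rangle=\overline k\langle v_1,v_2\rangle$, $\langle v_1,v_2k\rangle=\langle v_1,v_2\rangle k$, $\langle v_1,v_2\rangle=\overline{\langle v_2,v_1\rangle}$. A point of $\mathbb P_{\mathbb K}V$, a representative in $V$, and the corresponding one-dimensional subspace are denoted by the same letter. A point $p$ is isotropic if $\langle p,p\rangle=0$; $SV$ is the set of isotropic points. For $p$ nonisotropic, $V=p\oplus p^\perp$ and $T_p\mathbb P_{\mathbb K}V=\mathrm{Lin}_{\mathbb K}(p,p^\perp)$, where $\varphi:p\to p^\perp$ corresponds to the derivation $f\mapsto\frac{d}{d\varepsilon}|_{\varepsilon=0}\hat f(p+\varepsilon\varphi p)$, $\hat f$ being the lift of $f$ to $V\setminus\{0\}$. Extending by zero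 on $p^\perp$, tangent vectors at $p$ are regarded as elements of $\mathrm{Lin}_{\mathbb K}(V,V)$, so that products are compositions of linear maps $V\to V$; $t^*$ denotes the adjoint of $t$ with respect to $\langle-,-\rangle$. The metric is $(t_1,t_2):=\pm\frac{\mathrm{tr}_{\mathbb R}(t_1^*t_2)}{\dim_{\mathbb R}\mathbb K}$ for $t_1,t_2\in T_p\mathbb P_{\mathbb K}V$ (one of the signs being fixed); it is a pseudo-riemannian metric on $\mathbb P_{\mathbb K}V\setminus SV$. *)

theory Defs
  imports "HOL-Analysis.Analysis"
begin

section \<open>The scalars: real numbers, complex numbers, quaternions\<close>

text \<open>
  Real, complex and quaternionic scalars are treated uniformly by a type class with
  instances for all three. By Frobenius' theorem a finite-dimensional associative real division
  algebra is isomorphic to one of the three; the last axiom below then forces the conjugation and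
  the norm to be the standard ones, so the class has no further models.
\<close>

class rch_algebra = real_normed_div_algebra + euclidean_space +
  fixes kconj :: "'a \<Rightarrow> 'a"
  assumes kconj_add: "kconj (x + y) = kconj x + kconj y"
    and kconj_mult: "kconj (x * y) = kconj y * kconj x"
    and kconj_kconj: "kconj (kconj x) = x"
    and mult_kconj: "x * kconj x = (norm x * norm x) *\<^sub>R 1"

instantiation real :: rch_algebra
begin

definition "kconj (x :: real) = x"

instance
  by standard (auto simp: kconj_real_def power2_eq_square)

end

instantiation complex :: rch_algebra
begin

definition "kconj (x :: complex) = cnj x"

instance
  by standard (auto simp: kconj_complex_def complex_norm_square[symmetric] power2_eq_square[symmetric] of_real_def[symmetric] simp del: of_real_power)

end

datatype quat = Quat (q1: real) (qi: real) (qj: real) (qk: real)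

lemma quat_eq_iff: "x = y \<longleftrightarrow> q1 x = q1 y \<and> qi x = qi y \<and> qj x = qj y \<and> qk x = qk y"
  by (cases x; cases y) auto

instantiation quat :: real_algebra_1
begin

definition "0 = Quat 0 0 0 0"
definition "1 = Quat 1 0 0 0"
definition "x + y = Quat (q1 x + q1 y) (qi x + qi y) (qj x + qj y) (qk x + qk y)"
definition "- x = Quat (- q1 x) (- qi x) (- qj x) (- qk x)"
definition "x - y = Quat (q1 x - q1 y) (qi x - qi y) (qj x - qj y) (qk x - qk y)"
definition "r *\<^sub>R x = Quat (r * q1 x) (r * qi x) (r * qj x) (r * qk x)"
definition "x * y = Quat
  (q1 x * q1 y - qi x * qi y - qj x * qj y - qk x * qk y)
  (q1 x * qi y + qi x * q1 y + qj x * qk y - qk x * qj y)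
  (q1 x * qj y - qi x * qk y + qj x * q1 y + qk x * qi y)
  (q1 x * qk y + qi x * qj y - qj x * qi y + qk x * q1 y)"

lemmas quat_arith_defs = zero_quat_def one_quat_def plus_quat_def uminus_quat_def minus_quat_def
  scaleR_quat_def times_quat_def

instance
proof
  fix x y z :: quat and r s :: real
  show "x * y * z = x * (y * z)"
    by (simp add: quat_arith_defs algebra_simps)
  show "1 * x = x" "x * 1 = x" "0 + x = x" "- x + x = 0" "x - y = x + - y" "(0 :: quat) \<noteq> 1"
    by (simp_all add: quat_arith_defs)
  show "x + y + z = x + (y + z)" "x + y = y + x"
    by (simp_all add: quat_arith_defs)
  show "(x + y) * z = x * z + y * z" "x * (y + z) = x * y + x * z"
    by (simp_all add: quat_arith_defs algebra_simps)
  show "r *\<^sub>R (x + y) = r *\<^sub>R x + r *\<^sub>R y" "(r + s) *\<^sub>R x = r *\<^sub>R x + s *\<^sub>R x"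
    "r *\<^sub>R s *\<^sub>R x = (r * s) *\<^sub>R x" "1 *\<^sub>R x = x"
    "r *\<^sub>R x * y = r *\<^sub>R (x * y)" "x * r *\<^sub>R y = r *\<^sub>R (x * y)"
    by (simp_all add: quat_arith_defs algebra_simps)
qed

end

instantiation quat :: real_normed_div_algebra
begin

definition norm_quat_def:
  "norm x = sqrt ((q1 x)\<^sup>2 + (qi x)\<^sup>2 + (qj x)\<^sup>2 + (qk x)\<^sup>2)"
definition inverse_quat_def:
  "inverse x = Quat (q1 x / (norm x)\<^sup>2) (- qi x / (norm x)\<^sup>2) (- qj x / (norm x)\<^sup>2) (- qk x / (norm x)\<^sup>2)"
definition divide_quat_def: "x div (y :: quat) = x * inverse y"
definition sgn_quat_def: "sgn (x :: quat) = x /\<^sub>R norm x"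
definition dist_quat_def: "dist (x :: quat) y = norm (x - y)"
definition uniformity_quat_def:
  "(uniformity :: (quat \<times> quat) filter) = (INF e\<in>{0 <..}. principal {(x, y). dist x y < e})"
definition open_quat_def:
  "open (U :: quat set) \<longleftrightarrow> (\<forall>x\<in>U. eventually (\<lambda>(x', y). x' = x \<longrightarrow> y \<in> U) uniformity)"

lemma norm_quat_sq: "(norm (x :: quat))\<^sup>2 = (q1 x)\<^sup>2 + (qi x)\<^sup>2 + (qj x)\<^sup>2 + (qk x)\<^sup>2"
  by (simp add: norm_quat_def)

lemma norm_quat_sq_eq_0:
  "(q1 x)\<^sup>2 + (qi x)\<^sup>2 + (qj x)\<^sup>2 + (qk x)\<^sup>2 = 0 \<longleftrightarrow> x = 0"
  by (simp add: quat_eq_iff zero_quat_def add_nonneg_eq_0_iff)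

lemma quat_triangle:
  fixes x y :: quat
  shows "norm (x + y) \<le> norm x + norm y"
proof -
  have n: "norm z = norm ((q1 z, qi z), (qj z, qk z))" for z :: quat
    by (simp add: norm_quat_def norm_prod_def)
  have "norm (x + y) = norm (((q1 x, qi x), (qj x, qk x)) + ((q1 y, qi y), (qj y, qk y)))"
    unfolding n[of "x + y"] by (simp add: plus_quat_def)
  also have "\<dots> \<le> norm x + norm y"
    unfolding n[of x] n[of y] by (rule norm_triangle_ineq)
  finally show ?thesis .
qed

instance
proof
  fix x y :: quat and r :: real
  show "inverse x * x = 1" "x * inverse x = 1" if "x \<noteq> 0"
  proof -
    define N where "N = (norm x)\<^sup>2"
    have nz: "N \<noteq> 0"
      using that norm_quat_sq_eq_0[of x] by (simp add: N_def norm_quat_sq del: power_eq_0_iff)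
    have N: "q1 x * q1 x + qi x * qi x + qj x * qj x + qk x * qk x = N"
      unfolding N_def norm_quat_sq by (simp add: power2_eq_square)
    have i: "inverse x = inverse N *\<^sub>R Quat (q1 x) (- qi x) (- qj x) (- qk x)"
      by (simp add: inverse_quat_def N_def scaleR_quat_def field_simps)
    have "Quat (q1 x) (- qi x) (- qj x) (- qk x) * x = N *\<^sub>R 1"
      "x * Quat (q1 x) (- qi x) (- qj x) (- qk x) = N *\<^sub>R 1"
      unfolding N[symmetric] by (simp_all add: quat_arith_defs mult.commute)
    then show "inverse x * x = 1" "x * inverse x = 1"
      unfolding i using nz by simp_all
  qed
  show "inverse (0 :: quat) = 0"
    by (simp add: inverse_quat_def zero_quat_def)
  show "norm x = 0 \<longleftrightarrow> x = 0"
    using norm_quat_sq_eq_0[of x] by (simp add: norm_quat_def)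
  show "norm (x + y) \<le> norm x + norm y"
    by (rule quat_triangle)
  show "norm (r *\<^sub>R x) = \<bar>r\<bar> * norm x"
  proof -
    have "norm (r *\<^sub>R x)
        = sqrt (r\<^sup>2 * ((q1 x)\<^sup>2 + (qi x)\<^sup>2 + (qj x)\<^sup>2 + (qk x)\<^sup>2))"
      by (simp add: norm_quat_def scaleR_quat_def power_mult_distrib distrib_left)
    then show ?thesis
      by (simp add: norm_quat_def real_sqrt_mult)
  qed
  show "norm (x * y) = norm x * norm y"
  proof -
    define c where "c z = Quat (q1 z) (- qi z) (- qj z) (- qk z)" for z :: quat
    have zc: "z * c z = (norm z)\<^sup>2 *\<^sub>R 1" for z
      unfolding norm_quat_sq by (simp add: c_def quat_arith_defs power2_eq_square mult.commute)
    have c_mult: "c (x * y) = c y * c x"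
      by (simp add: c_def quat_arith_defs algebra_simps)
    have "(norm (x * y))\<^sup>2 *\<^sub>R (1 :: quat) = x * (y * c y) * c x"
      by (simp add: zc[symmetric] c_mult mult.assoc)
    also have "\<dots> = (norm y)\<^sup>2 *\<^sub>R (x * c x)"
      by (simp only: zc mult_scaleR_right mult_scaleR_left mult_1_right)
    also have "\<dots> = ((norm x)\<^sup>2 * (norm y)\<^sup>2) *\<^sub>R 1"
      by (simp add: zc mult.commute)
    finally have "(norm (x * y))\<^sup>2 = (norm x)\<^sup>2 * (norm y)\<^sup>2"
      by (simp add: scaleR_quat_def one_quat_def)
    moreover have "norm z \<ge> 0" for z :: quat
      by (simp add: norm_quat_def)
    ultimately show ?thesis
      by (metis mult_nonneg_nonneg power2_eq_imp_eq power_mult_distrib)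
  qed
qed (rule divide_quat_def sgn_quat_def dist_quat_def uniformity_quat_def open_quat_def)+

end

instantiation quat :: euclidean_space
begin

definition inner_quat_def:
  "inner x y = q1 x * q1 y + qi x * qi y + qj x * qj y + qk x * qk y"

definition Basis_quat_def:
  "Basis = {Quat 1 0 0 0, Quat 0 1 0 0, Quat 0 0 1 0, Quat 0 0 0 1}"

instance
proof
  fix x y z u v :: quat and r :: real
  show "inner x y = inner y x"
    by (simp add: inner_quat_def mult.commute)
  show "inner (x + y) z = inner x z + inner y z" "inner (r *\<^sub>R x) y = r * inner x y"
    by (simp_all add: inner_quat_def quat_arith_defs algebra_simps)
  have sq: "inner x x = (norm x)\<^sup>2"
    unfolding norm_quat_sq by (simp add: inner_quat_def power2_eq_square)
  show "0 \<le> inner x x" "inner x x = 0 \<longleftrightarrow> x = 0" "norm x = sqrt (inner x x)"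
    unfolding sq by simp_all
  show "finite (Basis :: quat set)" "(Basis :: quat set) \<noteq> {}"
    by (simp_all add: Basis_quat_def)
  show "inner u v = (if u = v then 1 else 0)" if "u \<in> Basis" "v \<in> Basis"
    using that unfolding Basis_quat_def
    by (elim insertE emptyE; simp add: inner_quat_def)
  show "(\<forall>u\<in>Basis. inner x u = 0) \<longleftrightarrow> x = 0"
    by (cases x) (simp add: Basis_quat_def inner_quat_def zero_quat_def conj_assoc)
qed

end

instantiation quat :: rch_algebra
begin

definition kconj_quat_def: "kconj x = Quat (q1 x) (- qi x) (- qj x) (- qk x)"

instance
proof
  fix x y :: quat
  show "kconj (x + y) = kconj x + kconj y" "kconj (x * y) = kconj y * kconj x" "kconj (kconj x) = x"
    by (simp_all add: kconj_quat_def quat_arith_defs algebra_simps)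
  show "x * kconj x = (norm x * norm x) *\<^sub>R 1"
    unfolding power2_eq_square[symmetric] norm_quat_sq
    by (simp add: kconj_quat_def quat_arith_defs power2_eq_square mult.commute)
qed

end

section \<open>Smooth maps and real traces\<close>

text \<open>Meant for open \<open>U\<close> in a finite-dimensional space; the higher derivatives are
  taken as iterated directional derivatives.\<close>

primrec Ck_on :: "nat \<Rightarrow> 'a::real_normed_vector set \<Rightarrow> ('a \<Rightarrow> 'b::real_normed_vector) \<Rightarrow> bool" where
  "Ck_on 0 U f \<longleftrightarrow> continuous_on U f"
| "Ck_on (Suc n) U f \<longleftrightarrow> (\<forall>x\<in>U. f differentiable at x)
     \<and> (\<forall>h. Ck_on n U (\<lambda>x. frechet_derivative f (at x) h))"

definition smooth_on :: "'a::real_normed_vector set \<Rightarrow> ('a \<Rightarrow> 'b::real_normed_vector) \<Rightarrow> bool" where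
  "smooth_on U f \<longleftrightarrow> (\<forall>n. Ck_on n U f)"

definition trace_real :: "('v::euclidean_space \<Rightarrow>\<^sub>L 'v) \<Rightarrow> real" where
  "trace_real t = (\<Sum>b\<in>Basis. blinfun_apply t b \<bullet> b)"

section \<open>Hermitian spaces and their projective geometry\<close>

text \<open>
  The norm and inner product of the type \<open>'v\<close> are auxiliary: they only provide the (unique)
  vector space topology of a finite-dimensional real vector space and are unrelated to the
  hermitian form. The type \<open>'v \<Rightarrow>\<^sub>L 'v\<close> consists of all real-linear maps.
\<close>

locale hermitian_space =
  fixes smult :: "'v::euclidean_space \<Rightarrow> 'k::rch_algebra \<Rightarrow> 'v"  (infixl \<open>\<cdot>\<close> 75)
    and form :: "'v \<Rightarrow> 'v \<Rightarrow> 'k"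
  assumes smult_add_left: "(v + w) \<cdot> k = v \<cdot> k + w \<cdot> k"
    and smult_add_right: "v \<cdot> (k + l) = v \<cdot> k + v \<cdot> l"
    and smult_mult: "v \<cdot> (k * l) = (v \<cdot> k) \<cdot> l"
    and smult_one: "v \<cdot> 1 = v"
    and smult_of_real: "v \<cdot> of_real r = r *\<^sub>R v"
    and form_add_left: "form (u + v) w = form u w + form v w"
    and form_add_right: "form u (v + w) = form u v + form u w"
    and form_smult_left: "form (v \<cdot> k) w = kconj k * form v w"
    and form_smult_right: "form v (w \<cdot> k) = form v w * k"
    and form_hermitian: "form v w = kconj (form w v)"
    and form_nondegenerate: "(\<And>w. form v w = 0) \<Longrightarrow> v = 0"
begin

definition line :: "'v \<Rightarrow> 'v set" where
  "line v = range (\<lambda>k. v \<cdot> k)"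

definition proj_space :: "'v set set" where
  "proj_space = {line v | v. v \<noteq> 0}"

definition isotropic :: "'v set \<Rightarrow> bool" where
  "isotropic p \<longleftrightarrow> (\<forall>v\<in>p. form v v = 0)"

definition nonisotropic_points :: "'v set set" where
  "nonisotropic_points = {p \<in> proj_space. \<not> isotropic p}"

definition perp :: "'v set \<Rightarrow> 'v set" where
  "perp p = {w. \<forall>v\<in>p. form v w = 0}"

definition K_linear :: "('v \<Rightarrow>\<^sub>L 'v) \<Rightarrow> bool" where
  "K_linear t \<longleftrightarrow> (\<forall>v k. blinfun_apply t (v \<cdot> k) = blinfun_apply t v \<cdot> k)"

definition tangent :: "'v set \<Rightarrow> ('v \<Rightarrow>\<^sub>L 'v) set" where
  "tangent p = {t. K_linear t \<and> (\<forall>v\<in>p. blinfun_apply t v \<in> perp p)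
                 \<and> (\<forall>w\<in>perp p. blinfun_apply t w = 0)}"

definition adj :: "('v \<Rightarrow>\<^sub>L 'v) \<Rightarrow> ('v \<Rightarrow>\<^sub>L 'v)" where
  "adj t = (THE t'. \<forall>v w. form (blinfun_apply t v) w = form v (blinfun_apply t' w))"

text \<open>\<open>\<sigma>\<close> is the fixed sign of the metric.\<close>

definition metric :: "real \<Rightarrow> ('v \<Rightarrow>\<^sub>L 'v) \<Rightarrow> ('v \<Rightarrow>\<^sub>L 'v) \<Rightarrow> real" where
  "metric \<sigma> t1 t2 = \<sigma> * trace_real (adj t1 o\<^sub>L t2) / DIM('k)"

subsection \<open>Smooth functions and vector fields on the space of nonisotropic points\<close>

text \<open>
  A map on the nonisotropic points is smooth iff its lift \<open>\<lambda>v. F (line v)\<close> to the open cone of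
  nonisotropic vectors is smooth. Functions on points are total; their values outside
  \<open>nonisotropic_points\<close> are irrelevant.
\<close>

definition smooth_map :: "('v set \<Rightarrow> 'b::real_normed_vector) \<Rightarrow> bool" where
  "smooth_map F \<longleftrightarrow> smooth_on {v. form v v \<noteq> 0} (\<lambda>v. F (line v))"

definition vector_field :: "('v set \<Rightarrow> 'v \<Rightarrow>\<^sub>L 'v) \<Rightarrow> bool" where
  "vector_field X \<longleftrightarrow> smooth_map X \<and> (\<forall>p\<in>nonisotropic_points. X p \<in> tangent p)"

text \<open>A tangent vector as a derivation; the value does not depend on the representative \<open>v\<close>.\<close>

definition derivation :: "'v set \<Rightarrow> ('v \<Rightarrow>\<^sub>L 'v) \<Rightarrow> ('v set \<Rightarrow> real) \<Rightarrow> real" where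
  "derivation p t f = (let v = (SOME v. v \<in> p \<and> v \<noteq> 0)
     in deriv (\<lambda>\<epsilon>. f (line (v + \<epsilon> *\<^sub>R blinfun_apply t v))) 0)"

definition field_deriv :: "('v set \<Rightarrow> 'v \<Rightarrow>\<^sub>L 'v) \<Rightarrow> ('v set \<Rightarrow> real) \<Rightarrow> ('v set \<Rightarrow> real)" where
  "field_deriv X f = (\<lambda>p. derivation p (X p) f)"

definition lie_bracket ::
    "('v set \<Rightarrow> 'v \<Rightarrow>\<^sub>L 'v) \<Rightarrow> ('v set \<Rightarrow> 'v \<Rightarrow>\<^sub>L 'v) \<Rightarrow> ('v set \<Rightarrow> 'v \<Rightarrow>\<^sub>L 'v)" where
  "lie_bracket X Y = (\<lambda>p. THE t. t \<in> tangent p \<and>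
     (\<forall>f. smooth_map f \<longrightarrow>
        derivation p t f = field_deriv X (field_deriv Y f) p - field_deriv Y (field_deriv X f) p))"

subsection \<open>Levi-Civita connection and curvature\<close>

definition affine_connection ::
    "(('v set \<Rightarrow> 'v \<Rightarrow>\<^sub>L 'v) \<Rightarrow> ('v set \<Rightarrow> 'v \<Rightarrow>\<^sub>L 'v) \<Rightarrow> ('v set \<Rightarrow> 'v \<Rightarrow>\<^sub>L 'v)) \<Rightarrow> bool" where
  "affine_connection D \<longleftrightarrow>
     (\<forall>X Y. vector_field X \<longrightarrow> vector_field Y \<longrightarrow> vector_field (D X Y)) \<and>
     (\<forall>X X' Y. vector_field X \<longrightarrow> vector_field X' \<longrightarrow> vector_field Y \<longrightarrow>
        (\<forall>p\<in>nonisotropic_points. D (\<lambda>q. X q + X' q) Y p = D X Y p + D X' Y p)) \<and>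
     (\<forall>f X Y. smooth_map f \<longrightarrow> vector_field X \<longrightarrow> vector_field Y \<longrightarrow>
        (\<forall>p\<in>nonisotropic_points. D (\<lambda>q. f q *\<^sub>R X q) Y p = f p *\<^sub>R D X Y p)) \<and>
     (\<forall>X Y Y'. vector_field X \<longrightarrow> vector_field Y \<longrightarrow> vector_field Y' \<longrightarrow>
        (\<forall>p\<in>nonisotropic_points. D X (\<lambda>q. Y q + Y' q) p = D X Y p + D X Y' p)) \<and>
     (\<forall>f X Y. smooth_map f \<longrightarrow> vector_field X \<longrightarrow> vector_field Y \<longrightarrow>
        (\<forall>p\<in>nonisotropic_points.
           D X (\<lambda>q. f q *\<^sub>R Y q) p = field_deriv X f p *\<^sub>R Y p + f p *\<^sub>R D X Y p))"

definition torsion_free ::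
    "(('v set \<Rightarrow> 'v \<Rightarrow>\<^sub>L 'v) \<Rightarrow> ('v set \<Rightarrow> 'v \<Rightarrow>\<^sub>L 'v) \<Rightarrow> ('v set \<Rightarrow> 'v \<Rightarrow>\<^sub>L 'v)) \<Rightarrow> bool" where
  "torsion_free D \<longleftrightarrow>
     (\<forall>X Y. vector_field X \<longrightarrow> vector_field Y \<longrightarrow>
        (\<forall>p\<in>nonisotropic_points. D X Y p - D Y X p = lie_bracket X Y p))"

definition metric_compatible :: "real \<Rightarrow>
    (('v set \<Rightarrow> 'v \<Rightarrow>\<^sub>L 'v) \<Rightarrow> ('v set \<Rightarrow> 'v \<Rightarrow>\<^sub>L 'v) \<Rightarrow> ('v set \<Rightarrow> 'v \<Rightarrow>\<^sub>L 'v)) \<Rightarrow> bool" where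
  "metric_compatible \<sigma> D \<longleftrightarrow>
     (\<forall>X Y Z. vector_field X \<longrightarrow> vector_field Y \<longrightarrow> vector_field Z \<longrightarrow>
        (\<forall>p\<in>nonisotropic_points.
           field_deriv X (\<lambda>q. metric \<sigma> (Y q) (Z q)) p
             = metric \<sigma> (D X Y p) (Z p) + metric \<sigma> (Y p) (D X Z p)))"

definition levi_civita :: "real \<Rightarrow>
    (('v set \<Rightarrow> 'v \<Rightarrow>\<^sub>L 'v) \<Rightarrow> ('v set \<Rightarrow> 'v \<Rightarrow>\<^sub>L 'v) \<Rightarrow> ('v set \<Rightarrow> 'v \<Rightarrow>\<^sub>L 'v)) \<Rightarrow> bool" where
  "levi_civita \<sigma> D \<longleftrightarrow> affine_connection D \<and> torsion_free D \<and> metric_compatible \<sigma> D"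

definition curvature_field ::
    "(('v set \<Rightarrow> 'v \<Rightarrow>\<^sub>L 'v) \<Rightarrow> ('v set \<Rightarrow> 'v \<Rightarrow>\<^sub>L 'v) \<Rightarrow> ('v set \<Rightarrow> 'v \<Rightarrow>\<^sub>L 'v)) \<Rightarrow>
     ('v set \<Rightarrow> 'v \<Rightarrow>\<^sub>L 'v) \<Rightarrow> ('v set \<Rightarrow> 'v \<Rightarrow>\<^sub>L 'v) \<Rightarrow> ('v set \<Rightarrow> 'v \<Rightarrow>\<^sub>L 'v) \<Rightarrow>
     ('v set \<Rightarrow> 'v \<Rightarrow>\<^sub>L 'v)" where
  "curvature_field D T1 T2 S =
     (\<lambda>q. D T2 (D T1 S) q - D T1 (D T2 S) q + D (lie_bracket T1 T2) S q)"

text \<open>The value of the curvature tensor on tangent vectors at \<open>p\<close>: the common value at \<open>p\<close> of the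
  curvature on all vector fields extending them. Global fields suffice, since every tangent vector
  at a nonisotropic point extends to a smooth field on all nonisotropic points.\<close>

definition curvature_tensor ::
    "(('v set \<Rightarrow> 'v \<Rightarrow>\<^sub>L 'v) \<Rightarrow> ('v set \<Rightarrow> 'v \<Rightarrow>\<^sub>L 'v) \<Rightarrow> ('v set \<Rightarrow> 'v \<Rightarrow>\<^sub>L 'v)) \<Rightarrow>
     'v set \<Rightarrow> ('v \<Rightarrow>\<^sub>L 'v) \<Rightarrow> ('v \<Rightarrow>\<^sub>L 'v) \<Rightarrow> ('v \<Rightarrow>\<^sub>L 'v) \<Rightarrow> ('v \<Rightarrow>\<^sub>L 'v)" where
  "curvature_tensor D p t1 t2 s =
     (THE r. \<forall>T1 T2 S. vector_field T1 \<and> vector_field T2 \<and> vector_field S \<and>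
                T1 p = t1 \<and> T2 p = t2 \<and> S p = s \<longrightarrow> curvature_field D T1 T2 S p = r)"

end

end

theory Submission
  imports Defs
begin

text \<open>
  Points are replaced by vectors: a field \<open>X\<close> of tangent maps is lifted to the map
  \<open>v \<mapsto> X (line v)\<close> on the open cone of nonisotropic vectors, where it can be differentiated as
  a map into the space of linear maps \<open>V \<rightarrow> V\<close>. Let \<open>P\<close> be the orthogonal projection onto the line of
  \<open>v\<close> and \<open>Q = 1 - P\<close>. The Levi-Civita connection is the derivative in the ambient linear space followed
  by the projection to the tangent space: \<open>\<nabla>\<^sub>X Y = Q \<circ> dY(X v) \<circ> P\<close>. This map is torsion-free
  (\<open>lie_bracket_line\<close>): \<open>X (Y f) - Y (X f)\<close> loses its second-order terms by Schwarz's theorem, and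
  derivatives of functions of points do not see components along the line of \<open>v\<close>. It is metric
  (\<open>nabla_metric\<close>), because \<open>P\<close> and \<open>Q\<close> are self-adjoint and so may be moved across the trace form.
  The metric is nondegenerate and tangent vectors extend to fields, so any two torsion-free metric
  connections agree (\<open>levi_civita_unique\<close>).

  The curvature then comes from one formula. In a tangent direction \<open>t\<close> the derivative of \<open>P\<close> is
  \<open>t + t\<^sup>*\<close> (\<open>proj_derivative_tangent\<close>). In \<open>\<nabla>\<^sub>T\<^sub>2 \<nabla>\<^sub>T\<^sub>1 S = Q \<circ> d(Q \<circ> dS \<circ> P) \<circ> P\<close>, the
  derivatives of the two outer projections give \<open>Q \<circ> dS(t\<^sub>1 v) \<circ> t\<^sub>2 - t\<^sub>2 \<circ> dS(t\<^sub>1 v) \<circ> P\<close>.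
  Differentiating the identities \<open>S \<circ> P = S\<close> and \<open>P \<circ> S = 0\<close> turns this into
  \<open>s t\<^sub>1\<^sup>* t\<^sub>2 + t\<^sub>2 t\<^sub>1\<^sup>* s\<close> (\<open>nabla_nabla\<close>). What is left is the projected second derivative of \<open>S\<close>
  together with a first derivative of \<open>S\<close>; antisymmetrized in \<open>T\<^sub>1\<close> and \<open>T\<^sub>2\<close>, it cancels
  against \<open>\<nabla>\<close> along the bracket \<open>[T\<^sub>1, T\<^sub>2]\<close>.
\<close>

section \<open>Calculus with iterated directional derivatives\<close>

lemma frechet_derivative_eqI:
  "(f has_derivative f') (at x) \<Longrightarrow> frechet_derivative f (at x) = f'"
  by (rule frechet_derivative_at[symmetric])

lemma differentiable_has_frechet:
  "f differentiable at x \<Longrightarrow> (f has_derivative frechet_derivative f (at x)) (at x)"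
  by (simp add: frechet_derivative_works)

lemma Ck_on_Suc_lower: "Ck_on (Suc n) U f \<Longrightarrow> Ck_on n U f"
proof (induction n arbitrary: f)
  case 0
  then show ?case
    by (auto intro: continuous_at_imp_continuous_on differentiable_imp_continuous_within)
next
  case (Suc n)
  then show ?case by (metis Ck_on.simps(2))
qed

lemma Ck_on_cong:
  assumes "open U" "\<And>x. x \<in> U \<Longrightarrow> f x = g x" "Ck_on n U f"
  shows "Ck_on n U g"
  using assms(2,3)
proof (induction n arbitrary: f g)
  case 0
  then show ?case by (simp cong: continuous_on_cong)
next
  case (Suc n)
  have eq: "frechet_derivative f (at x) = frechet_derivative g (at x)" and d: "g differentiable at x"
    if "x \<in> U" for x
  proof -
    have f: "(f has_derivative frechet_derivative f (at x)) (at x)"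
      using Suc.prems that by (simp add: frechet_derivative_works)
    have "(g has_derivative frechet_derivative f (at x)) (at x)"
      by (rule has_derivative_transform_within_open[OF f \<open>open U\<close> that Suc.prems(1)])
    then show "frechet_derivative f (at x) = frechet_derivative g (at x)" "g differentiable at x"
      by (auto simp: frechet_derivative_eqI differentiable_def)
  qed
  have "Ck_on n U (\<lambda>x. frechet_derivative g (at x) h)" for h
    by (rule Suc.IH[of "\<lambda>x. frechet_derivative f (at x) h"]) (use Suc.prems eq in auto)
  then show ?case using d by simp
qed

lemma Ck_on_const: "Ck_on n U (\<lambda>x. c)"
  by (induction n arbitrary: c) (auto simp: frechet_derivative_eqI[OF has_derivative_const])

lemma Ck_on_bounded_linear: "bounded_linear L \<Longrightarrow> Ck_on n U L"
proof (cases n)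
  case (Suc m)
  assume L: "bounded_linear L"
  then have "frechet_derivative L (at x) = L" for x
    by (intro frechet_derivative_eqI bounded_linear_imp_has_derivative)
  then show ?thesis
    using L Suc by (auto simp: Ck_on_const bounded_linear_imp_differentiable)
qed (auto simp: linear_continuous_on)

lemma Ck_on_add:
  assumes "open U" "Ck_on n U f" "Ck_on n U g"
  shows "Ck_on n U (\<lambda>x. f x + g x)"
  using assms(2,3)
proof (induction n arbitrary: f g)
  case 0
  then show ?case by (auto intro: continuous_intros)
next
  case (Suc n)
  have d: "((\<lambda>x. f x + g x) has_derivative
      (\<lambda>h. frechet_derivative f (at x) h + frechet_derivative g (at x) h)) (at x)" if "x \<in> U" for x
    using Suc.prems that by (intro has_derivative_add differentiable_has_frechet) auto
  have "Ck_on n U (\<lambda>x. frechet_derivative (\<lambda>x. f x + g x) (at x) h)" for h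
    by (rule Ck_on_cong[OF \<open>open U\<close> _ Suc.IH])
      (use Suc.prems in \<open>auto simp: frechet_derivative_eqI[OF d]\<close>)
  then show ?case using d by (auto simp: differentiable_def)
qed

lemma frechet_derivative_bounded_linear_comp:
  assumes "bounded_linear L" "f differentiable at x"
  shows "(\<lambda>y. L (f y)) differentiable at x"
    "frechet_derivative (\<lambda>y. L (f y)) (at x) = (\<lambda>h. L (frechet_derivative f (at x) h))"
  using bounded_linear.has_derivative[OF assms(1) differentiable_has_frechet[OF assms(2)]]
  by (auto simp: differentiable_def frechet_derivative_eqI)

lemma Ck_on_bounded_linear_comp:
  assumes "open U" "bounded_linear L" "Ck_on n U f"
  shows "Ck_on n U (\<lambda>x. L (f x))"
  using assms(3)
proof (induction n arbitrary: f)
  case 0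
  then show ?case by (auto intro: bounded_linear.continuous_on[OF assms(2)])
next
  case (Suc n)
  have "Ck_on n U (\<lambda>x. frechet_derivative (\<lambda>y. L (f y)) (at x) h)" for h
    by (rule Ck_on_cong[OF \<open>open U\<close> _ Suc.IH[of "\<lambda>x. frechet_derivative f (at x) h"]])
      (use Suc.prems in \<open>auto simp: frechet_derivative_bounded_linear_comp(2)[OF assms(2), of f]\<close>)
  then show ?case
    using Suc.prems frechet_derivative_bounded_linear_comp(1)[OF assms(2)] by auto
qed

lemma Ck_on_diff:
  assumes "open U" "Ck_on n U f" "Ck_on n U g"
  shows "Ck_on n U (\<lambda>x. f x - g x)"
  using Ck_on_add[OF assms(1,2) Ck_on_bounded_linear_comp[OF assms(1) bounded_linear_minus[OF bounded_linear_ident] assms(3)]]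
  by simp

lemma Ck_on_bilinear:
  assumes "open U" and B: "bounded_bilinear B" and "Ck_on n U f" "Ck_on n U g"
  shows "Ck_on n U (\<lambda>x. B (f x) (g x))"
  using assms(3,4)
proof (induction n arbitrary: f g)
  case 0
  then show ?case by (auto intro: bounded_bilinear.continuous_on[OF B])
next
  case (Suc n)
  let ?d = "\<lambda>x h. B (f x) (frechet_derivative g (at x) h) + B (frechet_derivative f (at x) h) (g x)"
  have d: "((\<lambda>x. B (f x) (g x)) has_derivative ?d x) (at x)" if "x \<in> U" for x
    using Suc.prems that
    by (intro bounded_bilinear.FDERIV[OF B] differentiable_has_frechet) auto
  have fg: "Ck_on n U f" "Ck_on n U g"
    using Suc.prems by (blast intro: Ck_on_Suc_lower)+
  have "Ck_on n U (\<lambda>x. frechet_derivative (\<lambda>x. B (f x) (g x)) (at x) h)" for h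
  proof (rule Ck_on_cong[OF \<open>open U\<close>])
    show "Ck_on n U (\<lambda>x. ?d x h)"
      using Suc.prems fg by (intro Ck_on_add[OF \<open>open U\<close>] Suc.IH) auto
  qed (auto simp: frechet_derivative_eqI[OF d])
  then show ?case using d by (auto simp: differentiable_def)
qed

lemma Ck_on_inverse:
  fixes f :: "'a::real_normed_vector \<Rightarrow> real"
  assumes "open U" "\<And>x. x \<in> U \<Longrightarrow> f x \<noteq> 0" "Ck_on n U f"
  shows "Ck_on n U (\<lambda>x. inverse (f x))"
  using assms(3)
proof (induction n)
  case 0
  then show ?case using assms(2) by (auto intro: continuous_intros)
next
  case (Suc n)
  let ?d = "\<lambda>x h. - (inverse (f x) * frechet_derivative f (at x) h * inverse (f x))"
  have d: "((\<lambda>x. inverse (f x)) has_derivative ?d x) (at x)" if "x \<in> U" for x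
    using Suc.prems that assms(2)
    by (intro Deriv.has_derivative_inverse differentiable_has_frechet) auto
  have i: "Ck_on n U (\<lambda>x. inverse (f x))"
    using Suc by (blast intro: Ck_on_Suc_lower)
  have "Ck_on n U (\<lambda>x. frechet_derivative (\<lambda>x. inverse (f x)) (at x) h)" for h
  proof (rule Ck_on_cong[OF \<open>open U\<close>])
    show "Ck_on n U (\<lambda>x. (- 1) * (inverse (f x) * frechet_derivative f (at x) h * inverse (f x)))"
      using Suc.prems i
      by (intro Ck_on_bilinear[OF \<open>open U\<close> bounded_bilinear_mult] Ck_on_const) auto
  qed (auto simp: frechet_derivative_eqI[OF d])
  then show ?case using d by (auto simp: differentiable_def)
qed

lemma Ck_on_second_differentiable:
  assumes "Ck_on 2 U f" "x \<in> U"
  shows "f differentiable at x" "(\<lambda>y. frechet_derivative f (at y) h) differentiable at x"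
    "continuous_on U (\<lambda>y. frechet_derivative (\<lambda>z. frechet_derivative f (at z) h) (at y) k)"
  using assms by (auto simp: numeral_2_eq_2)

text \<open>
  The direction may vary with the point. Expanding it in the standard basis reduces the claim to
  fixed directions, which is all that \<open>Ck_on\<close> speaks about.
\<close>

lemma frechet_derivative_apply_has_derivative:
  fixes f :: "'a::euclidean_space \<Rightarrow> 'b::real_normed_vector"
  assumes U: "open U" "x \<in> U" and f: "Ck_on 2 U f" and g: "(g has_derivative g') (at x)"
  shows "((\<lambda>y. frechet_derivative f (at y) (g y)) has_derivative
    (\<lambda>h. frechet_derivative (\<lambda>y. frechet_derivative f (at y) (g x)) (at x) h
       + frechet_derivative f (at x) (g' h))) (at x)"
proof -
  let ?F = "\<lambda>y. frechet_derivative f (at y)"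
  have lin: "linear (?F y)" if "y \<in> U" for y
    using Ck_on_second_differentiable(1)[OF f that] by (rule linear_frechet_derivative)
  have exp: "?F y k = (\<Sum>b\<in>Basis. (k \<bullet> b) *\<^sub>R ?F y b)" if "y \<in> U" for y k
  proof -
    have "?F y k = ?F y (\<Sum>b\<in>Basis. (k \<bullet> b) *\<^sub>R b)" by (simp add: euclidean_representation)
    also have "\<dots> = (\<Sum>b\<in>Basis. (k \<bullet> b) *\<^sub>R ?F y b)"
      by (simp add: linear_sum[OF lin[OF that]] linear_scale[OF lin[OF that]])
    finally show ?thesis .
  qed
  have dF: "((\<lambda>y. ?F y b) has_derivative frechet_derivative (\<lambda>y. ?F y b) (at x)) (at x)" for b
    by (intro differentiable_has_frechet Ck_on_second_differentiable[OF f U(2)])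
  have *: "((\<lambda>y. \<Sum>b\<in>Basis. (k y \<bullet> b) *\<^sub>R ?F y b) has_derivative
      (\<lambda>h. \<Sum>b\<in>Basis. (k x \<bullet> b) *\<^sub>R frechet_derivative (\<lambda>y. ?F y b) (at x) h
         + (k' h \<bullet> b) *\<^sub>R ?F x b)) (at x)" if "(k has_derivative k') (at x)" for k k'
    by (intro has_derivative_sum has_derivative_scaleR dF has_derivative_inner_left that)
  have D2: "frechet_derivative (\<lambda>y. ?F y k) (at x) h
      = (\<Sum>b\<in>Basis. (k \<bullet> b) *\<^sub>R frechet_derivative (\<lambda>y. ?F y b) (at x) h)" for k h
  proof -
    have "((\<lambda>y. ?F y k) has_derivative
        (\<lambda>h. \<Sum>b\<in>Basis. (k \<bullet> b) *\<^sub>R frechet_derivative (\<lambda>y. ?F y b) (at x) h)) (at x)"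
    proof (rule has_derivative_transform_within_open[OF _ U])
      show "((\<lambda>y. \<Sum>b\<in>Basis. (k \<bullet> b) *\<^sub>R ?F y b) has_derivative
          (\<lambda>h. \<Sum>b\<in>Basis. (k \<bullet> b) *\<^sub>R frechet_derivative (\<lambda>y. ?F y b) (at x) h)) (at x)"
        using *[of "\<lambda>_. k" "\<lambda>_. 0"] by simp
    qed (rule exp[symmetric])
    from frechet_derivative_eqI[OF this] show ?thesis by simp
  qed
  show ?thesis
  proof (rule has_derivative_transform_within_open[OF _ U])
    have "(\<Sum>b\<in>Basis. (g x \<bullet> b) *\<^sub>R frechet_derivative (\<lambda>y. ?F y b) (at x) h + (g' h \<bullet> b) *\<^sub>R ?F x b)
        = frechet_derivative (\<lambda>y. ?F y (g x)) (at x) h + ?F x (g' h)" for h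
      unfolding D2[of "g x"] exp[OF U(2), of "g' h"] by (rule sum.distrib)
    with *[OF g] show "((\<lambda>y. \<Sum>b\<in>Basis. (g y \<bullet> b) *\<^sub>R ?F y b) has_derivative
        (\<lambda>h. frechet_derivative (\<lambda>y. ?F y (g x)) (at x) h + ?F x (g' h))) (at x)"
      by (simp only:)
  qed (rule exp[symmetric])
qed

text \<open>
  Two applications of the mean value theorem, first along \<open>h\<close> and then along \<open>k\<close>. The left-hand side
  is symmetric in \<open>h\<close> and \<open>k\<close>, which is the source of Schwarz's theorem.
\<close>

lemma mixed_second_difference:
  fixes f :: "'a::euclidean_space \<Rightarrow> real"
  assumes f: "Ck_on 2 U f" and t: "t > 0"
    and in_U: "\<And>a b. 0 \<le> a \<Longrightarrow> a \<le> t \<Longrightarrow> 0 \<le> b \<Longrightarrow> b \<le> t \<Longrightarrow> x + a *\<^sub>R h + b *\<^sub>R k \<in> U"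
  shows "\<exists>a b. 0 \<le> a \<and> a \<le> t \<and> 0 \<le> b \<and> b \<le> t \<and>
    f (x + t *\<^sub>R h + t *\<^sub>R k) - f (x + t *\<^sub>R h) - f (x + t *\<^sub>R k) + f x
     = t * (t * frechet_derivative (\<lambda>y. frechet_derivative f (at y) h) (at (x + a *\<^sub>R h + b *\<^sub>R k)) k)"
proof -
  let ?F = "\<lambda>y. frechet_derivative f (at y) h"
  have along: "((\<lambda>s. g (y + s *\<^sub>R l)) has_real_derivative frechet_derivative g (at (y + s *\<^sub>R l)) l) (at s)"
    if "g differentiable at (y + s *\<^sub>R l)" for g :: "'a \<Rightarrow> real" and y l s
  proof -
    have "((\<lambda>s. y + s *\<^sub>R l) has_derivative (\<lambda>r. r *\<^sub>R l)) (at s)"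
      by (auto intro!: derivative_eq_intros)
    then have "((\<lambda>s. g (y + s *\<^sub>R l)) has_derivative (\<lambda>r. frechet_derivative g (at (y + s *\<^sub>R l)) (r *\<^sub>R l))) (at s)"
      by (rule has_derivative_compose) (rule differentiable_has_frechet[OF that])
    moreover have "frechet_derivative g (at (y + s *\<^sub>R l)) (r *\<^sub>R l) = frechet_derivative g (at (y + s *\<^sub>R l)) l * r" for r
      using linear_scale[OF linear_frechet_derivative[OF that]] by simp
    ultimately show ?thesis by (simp add: has_field_derivative_def)
  qed
  \<comment> \<open>The second difference is the first difference of this function.\<close>
  define \<phi> where "\<phi> a = f (x + t *\<^sub>R k + a *\<^sub>R h) - f (x + a *\<^sub>R h)" for a
  have "(\<phi> has_real_derivative ?F (x + t *\<^sub>R k + a *\<^sub>R h) - ?F (x + a *\<^sub>R h)) (at a)"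
    if "0 \<le> a" "a \<le> t" for a
    unfolding \<phi>_def
    by (intro DERIV_diff along Ck_on_second_differentiable[OF f])
      (use in_U[of a t] in_U[of a 0] that t in \<open>auto simp: algebra_simps\<close>)
  from MVT2[OF t this] obtain a where a: "0 < a" "a < t"
    "\<phi> t - \<phi> 0 = t * (?F (x + t *\<^sub>R k + a *\<^sub>R h) - ?F (x + a *\<^sub>R h))"
    by auto
  have "((\<lambda>b. ?F (x + a *\<^sub>R h + b *\<^sub>R k)) has_real_derivative
      frechet_derivative ?F (at (x + a *\<^sub>R h + b *\<^sub>R k)) k) (at b)" if "0 \<le> b" "b \<le> t" for b
    by (intro along Ck_on_second_differentiable(2)[OF f]) (use in_U[of a b] a that in auto)
  from MVT2[OF t this] obtain b where b: "0 < b" "b < t"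
    "?F (x + a *\<^sub>R h + t *\<^sub>R k) - ?F (x + a *\<^sub>R h)
       = t * frechet_derivative ?F (at (x + a *\<^sub>R h + b *\<^sub>R k)) k"
    by auto
  have "\<phi> t - \<phi> 0 = f (x + t *\<^sub>R h + t *\<^sub>R k) - f (x + t *\<^sub>R h) - f (x + t *\<^sub>R k) + f x"
    by (simp add: \<phi>_def algebra_simps)
  then show ?thesis using a b
    by (intro exI[of _ a] exI[of _ b]) (auto simp: algebra_simps)
qed

text \<open>
  Schwarz's theorem: if the two mixed derivatives at \<open>x\<close> were at distance \<open>2 e\<close>, then by continuity
  those at any two points near \<open>x\<close> would differ too, but both equal the same second difference
  quotient at suitable points.
\<close>

lemma second_derivative_symmetric_real:
  fixes f :: "'a::euclidean_space \<Rightarrow> real"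
  assumes U: "open U" "x \<in> U" and f: "Ck_on 2 U f"
  shows "frechet_derivative (\<lambda>y. frechet_derivative f (at y) h) (at x) k
       = frechet_derivative (\<lambda>y. frechet_derivative f (at y) k) (at x) h"
proof (rule ccontr)
  let ?A = "\<lambda>y. frechet_derivative (\<lambda>y. frechet_derivative f (at y) h) (at y) k"
  let ?B = "\<lambda>y. frechet_derivative (\<lambda>y. frechet_derivative f (at y) k) (at y) h"
  assume ne: "?A x \<noteq> ?B x"
  define e where "e = dist (?A x) (?B x) / 2"
  have e: "e > 0" using ne by (simp add: e_def)
  have "\<forall>\<^sub>F y in nhds x. dist (g y) (g x) < e" if "continuous_on U g" for g :: "'a \<Rightarrow> real"
    using that U e by (auto simp: eventually_nhds_metric continuous_on_eq_continuous_at continuous_at_eps_delta)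
  then have "\<forall>\<^sub>F y in nhds x. y \<in> U \<and> dist (?A y) (?A x) < e \<and> dist (?B y) (?B x) < e"
    using U Ck_on_second_differentiable(3)[OF f U(2)]
    by (intro eventually_conj eventually_nhds_in_open) auto
  then obtain r where r: "r > 0" "\<And>y. dist y x < r \<Longrightarrow>
      y \<in> U \<and> dist (?A y) (?A x) < e \<and> dist (?B y) (?B x) < e"
    by (auto simp: eventually_nhds_metric)
  \<comment> \<open>Small enough that the parallelogram spanned by \<open>t h\<close> and \<open>t k\<close> at \<open>x\<close> lies in the ball of radius \<open>r\<close>.\<close>
  define t where "t = r / 2 / (norm h + norm k + 1)"
  have np: "norm h + norm k + 1 > 0" by (smt (verit) norm_ge_zero)
  have t: "t > 0" using r np by (simp add: t_def)
  have near: "dist (x + a *\<^sub>R h + b *\<^sub>R k) x < r" if "0 \<le> a" "a \<le> t" "0 \<le> b" "b \<le> t" for a b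
  proof -
    have "dist (x + a *\<^sub>R h + b *\<^sub>R k) x \<le> a * norm h + b * norm k"
      using norm_triangle_ineq[of "a *\<^sub>R h" "b *\<^sub>R k"] that by (simp add: dist_norm add.assoc)
    also have "\<dots> \<le> t * norm h + t * norm k"
      using that by (intro add_mono mult_right_mono) auto
    also have "\<dots> \<le> t * (norm h + norm k + 1)" using t by (simp add: algebra_simps)
    also have "\<dots> = r / 2"
      unfolding t_def using np by (metis less_irrefl nonzero_eq_divide_eq)
    also have "\<dots> < r" using r(1) by simp
    finally show ?thesis .
  qed
  obtain a b where ab: "0 \<le> a" "a \<le> t" "0 \<le> b" "b \<le> t"
    "f (x + t *\<^sub>R h + t *\<^sub>R k) - f (x + t *\<^sub>R h) - f (x + t *\<^sub>R k) + f x = t * (t * ?A (x + a *\<^sub>R h + b *\<^sub>R k))"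
    using mixed_second_difference[OF f t, of x h k] near r(2) by blast
  have sw: "x + a *\<^sub>R k + b *\<^sub>R h = x + b *\<^sub>R h + a *\<^sub>R k" for a b by simp
  have "\<exists>a b. 0 \<le> a \<and> a \<le> t \<and> 0 \<le> b \<and> b \<le> t \<and>
    f (x + t *\<^sub>R k + t *\<^sub>R h) - f (x + t *\<^sub>R k) - f (x + t *\<^sub>R h) + f x = t * (t * ?B (x + a *\<^sub>R k + b *\<^sub>R h))"
    by (rule mixed_second_difference[OF f t]) (use near r(2) in \<open>simp add: sw\<close>)
  then obtain a' b' where ab': "0 \<le> a'" "a' \<le> t" "0 \<le> b'" "b' \<le> t"
    "f (x + t *\<^sub>R h + t *\<^sub>R k) - f (x + t *\<^sub>R h) - f (x + t *\<^sub>R k) + f x = t * (t * ?B (x + b' *\<^sub>R h + a' *\<^sub>R k))"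
    by (auto simp: algebra_simps)
  have "?A (x + a *\<^sub>R h + b *\<^sub>R k) = ?B (x + b' *\<^sub>R h + a' *\<^sub>R k)"
    using ab(5) ab'(5) t by simp
  moreover have "dist (?A (x + a *\<^sub>R h + b *\<^sub>R k)) (?A x) < e" using r(2) near ab by blast
  moreover have "dist (?B (x + b' *\<^sub>R h + a' *\<^sub>R k)) (?B x) < e" using r(2) near ab' by blast
  ultimately show False
    unfolding e_def by (smt (verit) dist_real_def field_sum_of_halves)
qed

lemma second_derivative_symmetric_functional:
  fixes f :: "'a::euclidean_space \<Rightarrow> 'b::real_normed_vector"
  assumes U: "open U" "x \<in> U" and f: "Ck_on 2 U f" and L: "bounded_linear (L :: 'b \<Rightarrow> real)"
  shows "L (frechet_derivative (\<lambda>y. frechet_derivative f (at y) h) (at x) k)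
       = L (frechet_derivative (\<lambda>y. frechet_derivative f (at y) k) (at x) h)"
proof -
  have "frechet_derivative (\<lambda>y. frechet_derivative (\<lambda>z. L (f z)) (at y) h) (at x) k
      = L (frechet_derivative (\<lambda>y. frechet_derivative f (at y) h) (at x) k)" for h k
  proof -
    have eq: "frechet_derivative (\<lambda>z. L (f z)) (at y) h = L (frechet_derivative f (at y) h)" if "y \<in> U" for y
      using Ck_on_second_differentiable(1)[OF f that] by (simp add: frechet_derivative_bounded_linear_comp[OF L])
    have "((\<lambda>y. frechet_derivative (\<lambda>z. L (f z)) (at y) h) has_derivative
        (\<lambda>k. L (frechet_derivative (\<lambda>y. frechet_derivative f (at y) h) (at x) k))) (at x)"
      by (rule has_derivative_transform_within_open[OF _ U, of "\<lambda>y. L (frechet_derivative f (at y) h)"])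
        (auto intro!: bounded_linear.has_derivative[OF L] differentiable_has_frechet
          Ck_on_second_differentiable[OF f U(2)] simp: eq)
    from frechet_derivative_eqI[OF this] show ?thesis by simp
  qed
  then show ?thesis
    using second_derivative_symmetric_real[OF U Ck_on_bounded_linear_comp[OF U(1) L f]] by metis
qed

text \<open>
  Linear maps are separated by their matrix entries, so the scalar case suffices.
\<close>

lemma second_derivative_symmetric_blinfun:
  fixes f :: "'a::euclidean_space \<Rightarrow> ('b::real_normed_vector \<Rightarrow>\<^sub>L 'c::euclidean_space)"
  assumes U: "open U" "x \<in> U" and f: "Ck_on 2 U f"
  shows "frechet_derivative (\<lambda>y. frechet_derivative f (at y) h) (at x) k
       = frechet_derivative (\<lambda>y. frechet_derivative f (at y) k) (at x) h"
proof (rule blinfun_eqI, rule euclidean_eqI)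
  fix w :: 'b and b :: 'c assume "b \<in> Basis"
  have "bounded_linear (\<lambda>T. blinfun_apply T w \<bullet> b :: real)"
    by (intro bounded_linear_intros)
  from second_derivative_symmetric_functional[OF U f this]
  show "blinfun_apply (frechet_derivative (\<lambda>y. frechet_derivative f (at y) h) (at x) k) w \<bullet> b
      = blinfun_apply (frechet_derivative (\<lambda>y. frechet_derivative f (at y) k) (at x) h) w \<bullet> b" .
qed

section \<open>Conjugation, norm and trace of the scalars\<close>

lemma kconj_0 [simp]: "kconj (0 :: 'k::rch_algebra) = 0"
  using kconj_add[of "0 :: 'k" 0] by simp

lemma kconj_1 [simp]: "kconj (1 :: 'k::rch_algebra) = 1"
  by (metis kconj_kconj kconj_mult mult_1 mult_1_right)

lemma kconj_scaleR: "kconj (r *\<^sub>R x :: 'k::rch_algebra) = r *\<^sub>R kconj x"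
proof (cases "r = 0")
  case False
  have "(r *\<^sub>R 1) * kconj (r *\<^sub>R 1 :: 'k) = (r * r) *\<^sub>R 1"
    using mult_kconj[of "r *\<^sub>R 1 :: 'k"] by simp
  then have "r *\<^sub>R kconj (r *\<^sub>R 1 :: 'k) = r *\<^sub>R (r *\<^sub>R 1)" by simp
  with False have "kconj (r *\<^sub>R 1 :: 'k) = r *\<^sub>R 1"
    using scaleR_cancel_left by blast
  then show ?thesis using kconj_mult[of "r *\<^sub>R 1" x] by simp
qed simp

lemma inner_one_one [simp]: "(1 :: 'k::rch_algebra) \<bullet> 1 = 1"
  by (simp add: dot_square_norm)

text \<open>
  Obtained by expanding \<open>(x + 1) (x + 1)\<^sup>*\<close>. It makes the inner product with \<open>1\<close> the real part, for any
  of the three algebras at once.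
\<close>

lemma add_kconj: "x + kconj x = (2 * (x \<bullet> 1)) *\<^sub>R (1 :: 'k::rch_algebra)"
proof -
  have "(norm (x + 1) * norm (x + 1)) *\<^sub>R (1 :: 'k) = (x + 1) * (kconj x + 1)"
    using mult_kconj[of "x + 1"] by (simp add: kconj_add)
  also have "\<dots> = (norm x * norm x) *\<^sub>R 1 + (x + kconj x) + 1"
    by (simp add: algebra_simps mult_kconj)
  finally have "x + kconj x = (norm (x + 1) * norm (x + 1) - norm x * norm x - 1) *\<^sub>R 1"
    by (simp add: algebra_simps)
  also have "norm (x + 1) * norm (x + 1) - norm x * norm x - 1 = 2 * (x \<bullet> 1)"
    by (simp add: power2_norm_eq_inner inner_add inner_commute flip: power2_eq_square)
  finally show ?thesis .
qed

lemma inner_kconj_one [simp]: "kconj x \<bullet> 1 = x \<bullet> (1 :: 'k::rch_algebra)"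
  using arg_cong[OF add_kconj[of x], of "\<lambda>y. y \<bullet> 1"] by (simp add: inner_add)

lemma kconj_eq_self: "kconj x = x \<Longrightarrow> x = of_real (x \<bullet> (1 :: 'k::rch_algebra))"
  using add_kconj[of x] by (simp add: of_real_def scaleR_2[symmetric] flip: scaleR_scaleR)

lemma inner_mult_one_eq_0:
  fixes x :: "'k::rch_algebra"
  assumes "\<And>k. (x * k) \<bullet> 1 = 0" shows "x = 0"
  using assms[of "kconj x"] by (simp add: mult_kconj)

text \<open>
  Left multiplication by \<open>c\<close> is a similarity, because the norm is multiplicative; comparing the norms of
  \<open>c b + b\<close> and \<open>(c + 1) b\<close> gives its diagonal entries. Hence the real trace of left multiplication by
  \<open>c\<close> is the dimension of the algebra times the real part of \<open>c\<close>, which accounts for the normalization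
  of the metric.
\<close>

lemma inner_mult_self:
  fixes c b :: "'k::rch_algebra"
  shows "(c * b) \<bullet> b = (c \<bullet> 1) * (b \<bullet> b)"
proof -
  have n: "(x * y) \<bullet> (x * y) = (x \<bullet> x) * (y \<bullet> y)" for x y :: 'k
    by (simp add: dot_square_norm norm_mult power_mult_distrib)
  have "(c * b + b) \<bullet> (c * b + b) = ((c + 1) \<bullet> (c + 1)) * (b \<bullet> b)"
    using n[of "c + 1" b] by (simp add: algebra_simps)
  then show ?thesis
    by (simp add: inner_add n inner_commute algebra_simps)
qed

text \<open>
  The trace identity \<open>tr (g f) = tr (f g)\<close> for maps between two different spaces.
\<close>

lemma trace_commute:
  fixes f :: "'a::euclidean_space \<Rightarrow> 'b::euclidean_space"
  assumes "linear f" "linear g"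
  shows "(\<Sum>b\<in>Basis. g (f b) \<bullet> b) = (\<Sum>c\<in>Basis. f (g c) \<bullet> c)"
proof -
  have expand: "h x \<bullet> y = (\<Sum>c\<in>Basis. (x \<bullet> c) * (h c \<bullet> y))" if "linear h"
    for h :: "'c::euclidean_space \<Rightarrow> 'd::euclidean_space" and x y
    by (subst euclidean_representation[of x, symmetric])
      (simp only: linear_sum[OF that] linear_scale[OF that] inner_sum_left inner_scaleR_left)
  have "(\<Sum>b\<in>Basis. g (f b) \<bullet> b) = (\<Sum>b\<in>Basis. \<Sum>c\<in>Basis. (f b \<bullet> c) * (g c \<bullet> b))"
    by (simp add: expand[OF assms(2), of "f _"])
  also have "\<dots> = (\<Sum>c\<in>Basis. \<Sum>b\<in>Basis. (f b \<bullet> c) * (g c \<bullet> b))"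
    by (rule sum.swap)
  also have "\<dots> = (\<Sum>c\<in>Basis. f (g c) \<bullet> c)"
    by (simp add: expand[OF assms(1), of "g _"] mult.commute)
  finally show ?thesis .
qed

section \<open>Adjoints and the trace form\<close>

context hermitian_space
begin

lemma smult_scaleR_left: "(r *\<^sub>R v) \<cdot> k = r *\<^sub>R (v \<cdot> k)"
proof -
  have "(r *\<^sub>R v) \<cdot> k = v \<cdot> (of_real r * k)" by (simp add: smult_mult smult_of_real)
  also have "of_real r * k = k * of_real r" by (simp add: of_real_def)
  finally show ?thesis by (simp add: smult_mult smult_of_real)
qed

lemma smult_scaleR_right: "v \<cdot> (r *\<^sub>R k) = r *\<^sub>R (v \<cdot> k)"
proof -
  have "r *\<^sub>R k = k * of_real r" by (simp add: of_real_def)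
  then show ?thesis by (simp add: smult_mult smult_of_real)
qed

lemma form_scaleR_right: "form v (r *\<^sub>R w) = r *\<^sub>R form v w"
  using form_smult_right[of v w "of_real r"] by (simp add: smult_of_real) (simp add: of_real_def)

lemma form_scaleR_left: "form (r *\<^sub>R v) w = r *\<^sub>R form v w"
  by (subst (1 2) form_hermitian) (simp add: form_scaleR_right kconj_scaleR)

lemma bounded_bilinear_smult: "bounded_bilinear (\<cdot>)"
  unfolding bilinear_conv_bounded_bilinear[symmetric] bilinear_def
  by (auto intro!: linearI simp: smult_add_left smult_add_right smult_scaleR_left smult_scaleR_right)

lemma bounded_bilinear_form: "bounded_bilinear form"
  unfolding bilinear_conv_bounded_bilinear[symmetric] bilinear_def
  by (auto intro!: linearI simp: form_add_left form_add_right form_scaleR_left form_scaleR_right)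

sublocale smult: bounded_bilinear "(\<cdot>)" by (rule bounded_bilinear_smult)
sublocale form: bounded_bilinear form by (rule bounded_bilinear_form)

text \<open>
  The real part of the hermitian form is a nondegenerate symmetric real bilinear form that still
  determines it; adjoints and traces can be computed with it by real linear algebra.
\<close>

definition re_form :: "'v \<Rightarrow> 'v \<Rightarrow> real" where
  "re_form v w = form v w \<bullet> 1"

lemma bounded_bilinear_re_form: "bounded_bilinear re_form"
  unfolding bilinear_conv_bounded_bilinear[symmetric] bilinear_def
  by (auto intro!: linearI simp: re_form_def form.add_left form.add_right
      form.scaleR_left form.scaleR_right inner_add_left)

sublocale re_form: bounded_bilinear re_form by (rule bounded_bilinear_re_form)

lemma re_form_commute: "re_form v w = re_form w v"
  unfolding re_form_def by (subst form_hermitian) simp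

lemma re_form_nondegenerate: "(\<And>w. re_form v w = 0) \<Longrightarrow> v = 0"
  by (metis form_nondegenerate form_smult_right inner_mult_one_eq_0 re_form_def)

lemma form_right_eqI:
  assumes "\<And>v. form v a = form v b" shows "a = b"
proof -
  have "re_form (a - b) v = 0" for v
    unfolding re_form_commute[of "a - b"] using assms by (simp add: re_form_def form.diff_right)
  then show ?thesis using re_form_nondegenerate by fastforce
qed

lemma form_eqI:
  assumes "\<And>k. re_form (v \<cdot> k) w = re_form (v' \<cdot> k) w'"
  shows "form v w = form v' w'"
proof -
  have "form w v = form w' v'"
  proof -
    have *: "re_form (v \<cdot> k) w = (form w v * k) \<bullet> 1" for v w k
      unfolding re_form_commute[of "v \<cdot> k" w] by (simp add: re_form_def form_smult_right)
    have "((form w v - form w' v') * k) \<bullet> 1 = 0" for k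
      using assms[of k] by (simp add: * algebra_simps inner_diff_left)
    then show ?thesis using inner_mult_one_eq_0 by fastforce
  qed
  then show ?thesis by (metis form_hermitian)
qed

text \<open>
  Nondegeneracy makes \<open>re_form\<close> the inner product twisted by an injective, hence surjective,
  linear map.
\<close>

lemma riesz_re_form: "\<exists>u. \<forall>v. re_form v u = v \<bullet> b"
proof -
  define G where "G w = (\<Sum>b\<in>Basis. re_form b w *\<^sub>R b)" for w
  have G: "v \<bullet> G w = re_form v w" for v w
  proof -
    have "v \<bullet> G w = re_form (\<Sum>b\<in>Basis. (v \<bullet> b) *\<^sub>R b) w"
      by (simp add: G_def inner_sum_right re_form.sum_left re_form.scaleR_left mult.commute)
    then show ?thesis by (simp add: euclidean_representation)
  qed
  have lin: "linear G"
    by (rule linearI) (simp_all add: G_def re_form.add_right re_form.scaleR_right scaleR_left.add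
        sum.distrib scaleR_sum_right)
  have "inj G"
    using lin by (auto simp: linear_injective_0 intro!: re_form_nondegenerate)
      (metis G inner_zero_right re_form_commute)
  then obtain u where "G u = b"
    using linear_injective_imp_surjective[OF lin] by (metis surjD)
  then show ?thesis using G by auto
qed

text \<open>
  On the standard basis this is the basis dual to it with respect to \<open>re_form\<close>.
\<close>

definition dual :: "'v \<Rightarrow> 'v" where
  "dual b = (SOME u. \<forall>v. re_form v u = v \<bullet> b)"

lemma re_form_dual [simp]: "re_form v (dual b) = v \<bullet> b"
  using someI_ex[OF riesz_re_form[of b]] unfolding dual_def by blast

lemma dual_commute: "dual b \<bullet> c = dual c \<bullet> b"
  by (metis re_form_commute re_form_dual)

lemma K_linear_smult: "K_linear t \<Longrightarrow> t (v \<cdot> k) = t v \<cdot> k"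
  by (simp add: K_linear_def)

lemma adj_unique:
  assumes "\<And>v w. form (blinfun_apply t v) w = form v (blinfun_apply t' w)"
  shows "adj t = t'"
  unfolding adj_def
proof (rule the_equality)
  fix t'' assume *: "\<forall>v w. form (blinfun_apply t v) w = form v (blinfun_apply t'' w)"
  show "t'' = t'"
    by (intro blinfun_eqI form_right_eqI) (metis * assms)
qed (use assms in blast)

text \<open>
  The adjoint with respect to \<open>re_form\<close> exists for every real-linear map. For a \<open>K\<close>-linear one it is
  also the adjoint for the hermitian form, since \<open>form_eqI\<close> recovers that form from its real part.
\<close>

lemma form_adj:
  assumes "K_linear t"
  shows "form (blinfun_apply t v) w = form v (blinfun_apply (adj t) w)"
proof -
  define a where "a w = (\<Sum>b\<in>Basis. re_form (t b) w *\<^sub>R dual b)" for w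
  have "linear a"
    by (rule linearI) (simp_all add: a_def re_form.add_right re_form.scaleR_right scaleR_left.add
        sum.distrib scaleR_sum_right)
  then have a: "blinfun_apply (Blinfun a) = a"
    by (simp add: bounded_linear_Blinfun_apply linear_conv_bounded_linear)
  have re: "re_form (t v) w = re_form v (a w)" for v w
  proof -
    have "re_form (t v) w = re_form (t (\<Sum>b\<in>Basis. (v \<bullet> b) *\<^sub>R b)) w"
      by (simp add: euclidean_representation)
    also have "\<dots> = re_form v (a w)"
      by (simp add: a_def blinfun.sum_right blinfun.scaleR_right re_form.sum_left re_form.sum_right
          re_form.scaleR_left re_form.scaleR_right mult.commute)
    finally show ?thesis .
  qed
  have *: "form (t v) w = form v (Blinfun a w)" for v w
    by (rule form_eqI) (simp add: a re flip: K_linear_smult[OF assms])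
  show ?thesis unfolding adj_unique[OF *] by (rule *)
qed

lemma trace_real_dual: "trace_real A = (\<Sum>b\<in>Basis. re_form (A b) (dual b))"
  by (simp add: trace_real_def)

text \<open>
  The metric up to a constant, written without the adjoint: in this form it is visibly
  bilinear, and differentiating it needs no continuity of the adjoint.
\<close>

definition trace_form :: "('v \<Rightarrow>\<^sub>L 'v) \<Rightarrow> ('v \<Rightarrow>\<^sub>L 'v) \<Rightarrow> real" where
  "trace_form t z = (\<Sum>b\<in>Basis. re_form (t (dual b)) (z b))"

lemma metric_eq_trace_form:
  assumes "K_linear t"
  shows "metric \<sigma> t z = \<sigma> * trace_form t z / DIM('k)"
proof -
  have "re_form (adj t (z b)) (dual b) = re_form (t (dual b)) (z b)" for b
    unfolding re_form_commute[of _ "dual b"] by (simp add: re_form_def form_adj[OF assms])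
  then show ?thesis by (simp add: metric_def trace_real_dual trace_form_def del: re_form_dual)
qed

lemma trace_form_double_sum:
  "trace_form t z = (\<Sum>b\<in>Basis. \<Sum>c\<in>Basis. (dual b \<bullet> c) * re_form (t c) (z b))"
proof -
  have "re_form (t (dual b)) (z b) = (\<Sum>c\<in>Basis. (dual b \<bullet> c) * re_form (t c) (z b))" for b
    by (subst euclidean_representation[of "dual b", symmetric])
      (simp only: blinfun.sum_right blinfun.scaleR_right re_form.sum_left re_form.scaleR_left real_scaleR_def)
  then show ?thesis by (simp add: trace_form_def)
qed

lemma trace_form_commute: "trace_form t z = trace_form z t"
  unfolding trace_form_double_sum
  by (subst sum.swap) (simp add: dual_commute re_form_commute)

lemma trace_form_compose_left:
  assumes "\<And>v w. re_form (blinfun_apply S v) w = re_form v (blinfun_apply S' w)"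
  shows "trace_form (S o\<^sub>L t) z = trace_form t (S' o\<^sub>L z)"
  by (simp add: trace_form_def assms)

text \<open>
  The counterpart of moving \<open>S\<close> cyclically to the other end of the trace of \<open>(t S)\<^sup>* z\<close>.
\<close>

lemma trace_form_compose_right:
  assumes "\<And>v w. re_form (blinfun_apply S v) w = re_form v (blinfun_apply S' w)"
  shows "trace_form (t o\<^sub>L S) z = trace_form t (z o\<^sub>L S')"
proof -
  have "S (dual b) \<bullet> c = S' (dual c) \<bullet> b" for b c
    by (metis assms re_form_commute re_form_dual)
  then have Sd: "S (dual b) = (\<Sum>c\<in>Basis. (S' (dual c) \<bullet> b) *\<^sub>R c)" for b
    by (metis (no_types, lifting) euclidean_representation sum.cong)
  have "trace_form (t o\<^sub>L S) z = (\<Sum>b\<in>Basis. \<Sum>c\<in>Basis. (S' (dual c) \<bullet> b) * re_form (t c) (z b))"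
    by (simp add: trace_form_def Sd blinfun.sum_right blinfun.scaleR_right re_form.sum_left re_form.scaleR_left)
  also have "\<dots> = (\<Sum>c\<in>Basis. re_form (t c) (z (\<Sum>b\<in>Basis. (S' (dual c) \<bullet> b) *\<^sub>R b)))"
    by (subst sum.swap) (simp add: blinfun.sum_right blinfun.scaleR_right re_form.sum_right re_form.scaleR_right)
  also have "\<dots> = trace_form (z o\<^sub>L S') t"
    by (simp add: euclidean_representation trace_form_def re_form_commute)
  finally show ?thesis by (simp add: trace_form_commute)
qed

definition rank_one :: "'v \<Rightarrow> 'v \<Rightarrow> ('v \<Rightarrow>\<^sub>L 'v)" where
  "rank_one u v = Blinfun (\<lambda>w. u \<cdot> form v w)"

lemma rank_one_apply [simp]: "blinfun_apply (rank_one u v) w = u \<cdot> form v w"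
  unfolding rank_one_def
  by (subst bounded_linear_Blinfun_apply)
    (auto intro: bounded_linear_compose[OF smult.bounded_linear_right form.bounded_linear_right])

lemma bounded_bilinear_rank_one: "bounded_bilinear rank_one"
  unfolding bilinear_conv_bounded_bilinear[symmetric] bilinear_def
  by (auto intro!: linearI blinfun_eqI simp: blinfun.add_left blinfun.scaleR_left
      smult_add_left smult_scaleR_left form_add_left form_scaleR_left smult_add_right smult_scaleR_right)

sublocale rank_one: bounded_bilinear rank_one by (rule bounded_bilinear_rank_one)

text \<open>
  The map \<open>t\<^sup>* (rank_one u v)\<close> factors through the scalars, so its trace is the trace of
  left multiplication by \<open>\<langle>v, t\<^sup>* u\<rangle>\<close>. Pairing \<open>t\<close> with such maps detects all of \<open>t v\<close>.
\<close>

lemma trace_form_rank_one: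
  assumes "K_linear t"
  shows "trace_form t (rank_one u v) = real DIM('k) * re_form (t v) u"
proof -
  let ?a = "adj t u"
  have "trace_form t (rank_one u v) = (\<Sum>b\<in>Basis. (?a \<cdot> form v b) \<bullet> b)"
  proof -
    have "re_form (t x) (u \<cdot> k) = re_form x (?a \<cdot> k)" for x k
      by (simp add: re_form_def form_adj[OF assms] form_smult_right)
    then show ?thesis
      by (simp add: trace_form_def re_form_commute[of "dual b" for b])
  qed
  also have "\<dots> = (\<Sum>c\<in>Basis. form v (?a \<cdot> c) \<bullet> c)"
    by (rule trace_commute) (auto intro: bounded_linear.linear form.bounded_linear_right smult.bounded_linear_right)
  also have "\<dots> = (\<Sum>c\<in>(Basis :: 'k set). form v ?a \<bullet> 1)"
    by (rule sum.cong) (simp_all add: form_smult_right inner_mult_self inner_Basis)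
  finally show ?thesis
    by (simp add: re_form_def form_adj[OF assms])
qed

section \<open>Nonisotropic vectors and orthogonal projections\<close>

lemma form_self: "form v v = re_form v v *\<^sub>R 1"
  using kconj_eq_self[of "form v v"] form_hermitian[of v v] by (simp add: re_form_def of_real_def)

definition cone :: "'v set" where
  "cone = {v. form v v \<noteq> 0}"

lemma cone_iff: "v \<in> cone \<longleftrightarrow> re_form v v \<noteq> 0"
  using form_self[of v] by (auto simp: cone_def re_form_def)

lemma cone_nonzero: "v \<in> cone \<Longrightarrow> v \<noteq> 0"
  by (auto simp: cone_def form.zero_left)

lemma open_cone: "open cone"
proof -
  have "continuous_on UNIV (\<lambda>v. form v v)" by (intro form.continuous_on continuous_on_id)
  then have "open ((\<lambda>v. form v v) -` (- {0}))" by (rule open_vimage[rotated]) auto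
  then show ?thesis by (simp add: cone_def vimage_def)
qed

lemma smult_inverse: "k \<noteq> 0 \<Longrightarrow> v \<cdot> k \<cdot> inverse k = v"
  by (simp add: smult_one flip: smult_mult)

lemma kconj_eq_0_iff [simp]: "kconj (k :: 'k) = 0 \<longleftrightarrow> k = 0"
  by (metis kconj_0 kconj_kconj)

lemma cone_smult: "v \<in> cone \<Longrightarrow> k \<noteq> 0 \<Longrightarrow> v \<cdot> k \<in> cone"
  by (simp add: cone_def form_smult_left form_smult_right)

lemma mem_line: "v \<in> line v"
  unfolding line_def by (metis rangeI smult_one)

lemma line_smult: "k \<noteq> 0 \<Longrightarrow> line (v \<cdot> k) = line v"
proof -
  assume k: "k \<noteq> 0"
  have "line (v \<cdot> k) \<subseteq> line v" for v k by (auto simp: line_def simp flip: smult_mult)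
  from this[of v k] this[of "v \<cdot> k" "inverse k"] show ?thesis by (simp add: smult_inverse[OF k])
qed

lemma mem_line_nonzero:
  assumes "w \<in> line v" "w \<noteq> 0" obtains k where "k \<noteq> 0" "w = v \<cdot> k"
proof -
  from assms(1) obtain k where "w = v \<cdot> k" by (auto simp: line_def)
  then show ?thesis using that[of k] assms(2) by (cases "k = 0") (auto simp: smult.zero_right)
qed

lemma line_in_nonisotropic: "v \<in> cone \<Longrightarrow> line v \<in> nonisotropic_points"
  using mem_line[of v] cone_nonzero[of v]
  by (auto simp: nonisotropic_points_def proj_space_def isotropic_def cone_def)

lemma nonisotropic_pointE:
  assumes "p \<in> nonisotropic_points" obtains v where "v \<in> cone" "p = line v"
proof -
  from assms obtain v w where "p = line v" "w \<in> line v" "form w w \<noteq> 0"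
    by (auto simp: nonisotropic_points_def proj_space_def isotropic_def)
  moreover from this have "w \<noteq> 0" by (auto simp: form.zero_left)
  ultimately obtain k where "k \<noteq> 0" "w = v \<cdot> k" by (auto elim: mem_line_nonzero)
  then show ?thesis
    using that[of v] \<open>p = line v\<close> \<open>form w w \<noteq> 0\<close>
    by (auto simp: cone_def form_smult_left form_smult_right)
qed

lemma perp_line: "w \<in> perp (line v) \<longleftrightarrow> form v w = 0"
  using mem_line[of v] by (auto simp: perp_def line_def form_smult_left)

definition proj :: "'v \<Rightarrow> ('v \<Rightarrow>\<^sub>L 'v)" where
  "proj v = inverse (re_form v v) *\<^sub>R rank_one v v"

definition coproj :: "'v \<Rightarrow> ('v \<Rightarrow>\<^sub>L 'v)" where
  "coproj v = id_blinfun - proj v"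

lemma proj_apply: "proj v w = inverse (re_form v v) *\<^sub>R (v \<cdot> form v w)"
  by (simp add: proj_def blinfun.scaleR_left)

lemma coproj_apply [simp]: "coproj v w = w - proj v w"
  by (simp add: coproj_def blinfun.diff_left)

lemma proj_smult [simp]: "proj v (w \<cdot> k) = proj v w \<cdot> k"
  by (simp add: proj_apply form_smult_right smult_mult smult_scaleR_left)

lemma proj_self [simp]: "v \<in> cone \<Longrightarrow> proj v v = v"
  by (simp add: proj_apply form_self smult_scaleR_right smult_one cone_iff)

lemma form_proj: "form (proj v u) w = form u (proj v w)"
  by (simp add: proj_apply form_scaleR_left form_scaleR_right form_smult_left form_smult_right
      form_hermitian[of u v])

lemma form_proj_self [simp]: "v \<in> cone \<Longrightarrow> form v (proj v w) = form v w"
  by (simp flip: form_proj)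

lemma proj_perp: "form v w = 0 \<Longrightarrow> proj v w = 0"
  by (simp add: proj_apply smult.zero_right)

lemma proj_eq_0_iff: "v \<in> cone \<Longrightarrow> proj v w = 0 \<longleftrightarrow> form v w = 0"
  by (metis form.zero_right form_proj_self proj_perp)

lemma proj_proj [simp]: "v \<in> cone \<Longrightarrow> proj v (proj v w) = proj v w"
  by (simp add: proj_apply[of v w] blinfun.scaleR_right)

lemma proj_in_line: "\<exists>k. proj v w = v \<cdot> k"
  by (auto simp: proj_apply intro: exI[of _ "inverse (re_form v v) *\<^sub>R form v w"] simp: smult_scaleR_right)

text \<open>
  The projection depends on the line only: it is determined by its image and its kernel.
\<close>

lemma proj_rescale:
  assumes "v \<in> cone" "k \<noteq> 0" shows "proj (v \<cdot> k) = proj v"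
proof (rule blinfun_eqI)
  fix w
  have c: "v \<cdot> k \<in> cone" using assms by (rule cone_smult)
  obtain l where l: "proj v w = v \<cdot> l" using proj_in_line by blast
  have "v \<cdot> l = v \<cdot> k \<cdot> (inverse k * l)" using assms(2) by (simp flip: smult_mult mult.assoc)
  then have 1: "proj (v \<cdot> k) (proj v w) = proj v w" using c l by (metis proj_self proj_smult)
  have "proj (v \<cdot> k) (w - proj v w) = 0"
    using assms(1) by (intro proj_perp) (simp add: form_smult_left form.diff_right)
  with 1 show "proj (v \<cdot> k) w = proj v w" by (simp add: blinfun.diff_right)
qed

text \<open>
  Tangent maps as the \<open>K\<close>-linear maps \<open>t\<close> with \<open>P t = 0\<close> and \<open>t P = t\<close>. Being identities, these
  conditions can be differentiated along a field.
\<close>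

lemma tangent_line_iff:
  assumes v: "v \<in> cone"
  shows "t \<in> tangent (line v) \<longleftrightarrow>
    K_linear t \<and> (\<forall>w. proj v (t w) = 0) \<and> (\<forall>w. t (proj v w) = t w)" (is "_ \<longleftrightarrow> ?R")
proof
  assume t: "t \<in> tangent (line v)"
  then have K: "K_linear t" by (simp add: tangent_def)
  have ker: "t (proj v w) = t w" for w
  proof -
    have "form v (w - proj v w) = 0" using v by (simp add: form.diff_right)
    then have "t (w - proj v w) = 0" using t by (simp add: tangent_def perp_line)
    then show ?thesis by (simp add: blinfun.diff_right)
  qed
  have "proj v (t w) = 0" for w
  proof -
    have "form v (t v) = 0" using t mem_line[of v] by (auto simp: tangent_def perp_line)
    moreover obtain k where "proj v w = v \<cdot> k" using proj_in_line by blast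
    ultimately have "form v (t (proj v w)) = 0" by (simp add: K_linear_smult[OF K] form_smult_right)
    then show ?thesis by (simp add: ker proj_perp)
  qed
  then show ?R using K ker by blast
next
  assume R: ?R
  then have "t w = 0" if "form v w = 0" for w
    using proj_perp[OF that] by (metis blinfun.zero_right)
  moreover have "form v (t w) = 0" for w
    using R proj_eq_0_iff[OF v] by blast
  ultimately show "t \<in> tangent (line v)"
    using R by (simp add: tangent_def perp_line)
qed

lemma
  assumes "v \<in> cone" "t \<in> tangent (line v)"
  shows tangent_K_linear: "K_linear t"
    and proj_tangent [simp]: "proj v (t w) = 0"
    and tangent_proj [simp]: "t (proj v w) = t w"
    and form_tangent [simp]: "form v (t w) = 0"
    and tangent_tangent [simp]: "t' \<in> tangent (line v) \<Longrightarrow> t' (t w) = 0"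
proof -
  show "K_linear t" "proj v (t w) = 0" "t (proj v w) = t w" for w
    using assms by (auto simp: tangent_line_iff)
  then show f: "form v (t w) = 0" for w using proj_eq_0_iff[OF assms(1)] by blast
  show "t' (t w) = 0" if "t' \<in> tangent (line v)" for t'
    using that f by (simp add: tangent_def perp_line)
qed

lemma
  assumes "v \<in> cone" "t \<in> tangent (line v)"
  shows proj_adj [simp]: "proj v (adj t w) = adj t w"
    and adj_proj [simp]: "adj t (proj v w) = 0"
proof -
  note adj = form_adj[OF tangent_K_linear[OF assms], symmetric]
  show "proj v (adj t w) = adj t w"
    by (rule form_right_eqI) (simp add: adj assms flip: form_proj)
  show "adj t (proj v w) = 0"
    by (rule form_right_eqI) (simp add: adj assms form.zero_right flip: form_proj, simp add: form.zero_left assms)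
qed

lemma K_linear_diff: "K_linear s \<Longrightarrow> K_linear t \<Longrightarrow> K_linear (s - t)"
  and K_linear_compose: "K_linear s \<Longrightarrow> K_linear t \<Longrightarrow> K_linear (s o\<^sub>L t)"
  by (simp_all add: K_linear_def blinfun.diff_left smult.diff_left)

lemma K_linear_proj: "K_linear (proj v)" and K_linear_coproj: "K_linear (coproj v)"
  by (simp_all add: K_linear_def smult.diff_left)

lemma tangent_diff:
  assumes "v \<in> cone" "s \<in> tangent (line v)" "t \<in> tangent (line v)"
  shows "s - t \<in> tangent (line v)"
  using assms(2,3) unfolding tangent_line_iff[OF assms(1)]
  by (simp add: K_linear_diff blinfun.diff_left blinfun.diff_right)

lemma coproj_compose_tangent:
  assumes "v \<in> cone" "K_linear t" shows "coproj v o\<^sub>L t o\<^sub>L proj v \<in> tangent (line v)"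
  using assms(1) unfolding tangent_line_iff[OF assms(1)]
  by (simp add: blinfun.diff_right K_linear_compose K_linear_coproj K_linear_proj assms(2))

lemma coproj_tangent_proj:
  "v \<in> cone \<Longrightarrow> t \<in> tangent (line v) \<Longrightarrow> coproj v o\<^sub>L t o\<^sub>L proj v = t"
  by (rule blinfun_eqI) simp

lemma rank_one_tangent:
  assumes "v \<in> cone" "form v u = 0" shows "rank_one u v \<in> tangent (line v)"
  using assms(1) unfolding tangent_line_iff[OF assms(1)]
  by (simp add: K_linear_def form_smult_right smult_mult proj_perp[OF assms(2)] smult.zero_left)

text \<open>
  The maps \<open>rank_one u v\<close> with \<open>u\<close> orthogonal to \<open>v\<close> are tangent, and pairing with them shows that
  \<open>t v\<close> is orthogonal to everything.
\<close>

lemma metric_nondegenerate: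
  assumes v: "v \<in> cone" and \<sigma>: "\<sigma> \<noteq> 0" and t: "t \<in> tangent (line v)"
    and orth: "\<And>z. z \<in> tangent (line v) \<Longrightarrow> metric \<sigma> t z = 0"
  shows "t = 0"
proof -
  note K = tangent_K_linear[OF v t]
  have "re_form (t v) u = 0" for u
  proof -
    have "form v (u - proj v u) = 0" using v by (simp add: form.diff_right)
    then have "rank_one (u - proj v u) v \<in> tangent (line v)" by (rule rank_one_tangent[OF v])
    from orth[OF this] have "re_form (t v) (u - proj v u) = 0"
      using \<sigma> by (simp add: metric_eq_trace_form[OF K] trace_form_rank_one[OF K])
    moreover have "re_form (t v) (proj v u) = 0"
      using v t by (simp add: re_form_def form.zero_left flip: form_proj)
    ultimately show ?thesis by (simp add: re_form.diff_right)
  qed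
  then have "t v = 0" by (rule re_form_nondegenerate)
  have "t w = 0" for w
  proof -
    obtain k where "proj v w = v \<cdot> k" using proj_in_line by blast
    then have "t (proj v w) = 0" by (simp add: K_linear_smult[OF K] \<open>t v = 0\<close> smult.zero_left)
    then show ?thesis using v t by simp
  qed
  then show ?thesis by (intro blinfun_eqI) simp
qed

lemma Ck_on_proj: "Ck_on n cone proj"
proof -
  have id: "Ck_on n cone (\<lambda>x. x)" by (rule Ck_on_bounded_linear[OF bounded_linear_ident])
  show ?thesis
    unfolding proj_def[abs_def]
    by (intro Ck_on_bilinear[OF open_cone bounded_bilinear_scaleR] Ck_on_inverse[OF open_cone]
        Ck_on_bilinear[OF open_cone re_form.bounded_bilinear_axioms id id]
        Ck_on_bilinear[OF open_cone bounded_bilinear_rank_one id id])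
      (simp add: cone_iff)
qed

lemma proj_has_derivative:
  "v \<in> cone \<Longrightarrow> (proj has_derivative frechet_derivative proj (at v)) (at v)"
  using Ck_on_proj[of 1] by (simp add: differentiable_has_frechet)

text \<open>
  In a direction orthogonal to \<open>v\<close> the normalizing factor \<open>1 / \<langle>v, v\<rangle>\<close> is stationary.
\<close>

lemma proj_derivative_perp:
  assumes v: "v \<in> cone" and h: "form v h = 0"
  shows "frechet_derivative proj (at v) h = inverse (re_form v v) *\<^sub>R (rank_one h v + rank_one v h)"
proof -
  have N: "((\<lambda>x. re_form x x) has_derivative (\<lambda>k. re_form v k + re_form k v)) (at v)"
    by (intro re_form.FDERIV has_derivative_ident)
  have R: "((\<lambda>x. rank_one x x) has_derivative (\<lambda>k. rank_one v k + rank_one k v)) (at v)"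
    by (intro rank_one.FDERIV has_derivative_ident)
  have nz: "re_form v v \<noteq> 0" using v by (simp add: cone_iff)
  have "frechet_derivative proj (at v) = (\<lambda>k. inverse (re_form v v) *\<^sub>R (rank_one v k + rank_one k v)
      + (- (inverse (re_form v v) * (re_form v k + re_form k v) * inverse (re_form v v))) *\<^sub>R rank_one v v)"
    unfolding proj_def[abs_def]
    by (intro frechet_derivative_eqI has_derivative_scaleR Deriv.has_derivative_inverse nz N R)
  moreover have "re_form v h = 0" "re_form h v = 0"
    using h re_form_commute[of h v] by (simp_all add: re_form_def)
  ultimately show ?thesis by (simp add: add.commute)
qed

text \<open>
  The geometric heart of the curvature formula: the two summands of the previous derivative are
  \<open>t P = t\<close> and \<open>P t\<^sup>* = t\<^sup>*\<close>.
\<close>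

lemma proj_derivative_tangent:
  assumes v: "v \<in> cone" and t: "t \<in> tangent (line v)"
  shows "frechet_derivative proj (at v) (t v) = t + adj t"
proof (rule blinfun_eqI)
  fix w
  note K = tangent_K_linear[OF v t]
  have "inverse (re_form v v) *\<^sub>R (t v \<cdot> form v w) = t (proj v w)"
    by (simp add: proj_apply blinfun.scaleR_right K_linear_smult[OF K])
  moreover have "inverse (re_form v v) *\<^sub>R (v \<cdot> form (t v) w) = proj v (adj t w)"
    by (simp add: proj_apply form_adj[OF K])
  ultimately show "frechet_derivative proj (at v) (t v) w = (t + adj t) w"
    using v t by (simp add: proj_derivative_perp blinfun.add_left blinfun.scaleR_left scaleR_add_right)
qed

section \<open>Derivatives of functions and fields, lifted to the cone\<close>

definition lift_deriv :: "('v set \<Rightarrow> 'b::real_normed_vector) \<Rightarrow> 'v \<Rightarrow> 'v \<Rightarrow> 'b" where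
  "lift_deriv F v = frechet_derivative (\<lambda>x. F (line x)) (at v)"

definition lift_deriv2 :: "('v set \<Rightarrow> 'b::real_normed_vector) \<Rightarrow> 'v \<Rightarrow> 'v \<Rightarrow> 'v \<Rightarrow> 'b" where
  "lift_deriv2 F v h k = frechet_derivative (\<lambda>x. lift_deriv F x k) (at v) h"

lemma smooth_map_iff: "smooth_map F \<longleftrightarrow> (\<forall>n. Ck_on n cone (\<lambda>x. F (line x)))"
  by (simp add: smooth_map_def smooth_on_def cone_def)

lemma smooth_map_differentiable:
  "smooth_map F \<Longrightarrow> v \<in> cone \<Longrightarrow> (\<lambda>x. F (line x)) differentiable at v"
  using smooth_map_iff Ck_on_second_differentiable(1) by blast

lemma lift_has_derivative:
  "(\<lambda>x. F (line x)) differentiable at v \<Longrightarrow> ((\<lambda>x. F (line x)) has_derivative lift_deriv F v) (at v)"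
  unfolding lift_deriv_def by (rule differentiable_has_frechet)

lemma linear_lift_deriv: "(\<lambda>x. F (line x)) differentiable at v \<Longrightarrow> linear (lift_deriv F v)"
  unfolding lift_deriv_def by (rule linear_frechet_derivative)

lemma lift_deriv_eqI: "((\<lambda>x. F (line x)) has_derivative F') (at v) \<Longrightarrow> lift_deriv F v = F'"
  unfolding lift_deriv_def by (rule frechet_derivative_eqI)

text \<open>
  The device for differentiating an identity that holds on the whole cone.
\<close>

lemma cone_derivative_unique:
  assumes "v \<in> cone" "\<And>x. x \<in> cone \<Longrightarrow> f x = g x"
    and "(f has_derivative f') (at v)" "(g has_derivative g') (at v)"
  shows "f' h = g' h"
proof -
  have "(g has_derivative f') (at v)"
    by (rule has_derivative_transform_within_open[OF assms(3) open_cone assms(1,2)])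
  then show ?thesis using assms(4) by (metis has_derivative_unique)
qed

lemma smooth_map_cong:
  assumes "smooth_map F" "\<And>q. q \<in> nonisotropic_points \<Longrightarrow> F q = G q"
  shows "smooth_map G"
  unfolding smooth_map_iff
proof
  fix n
  show "Ck_on n cone (\<lambda>x. G (line x))"
    by (rule Ck_on_cong[OF open_cone, of "\<lambda>x. F (line x)"])
      (use assms line_in_nonisotropic in \<open>auto simp: smooth_map_iff\<close>)
qed

lemma lift_has_derivative_rescale:
  assumes d: "(\<lambda>x. F (line x)) differentiable at v" and k: "k \<noteq> 0"
  shows "((\<lambda>x. F (line x)) has_derivative (\<lambda>h. lift_deriv F v (h \<cdot> inverse k))) (at (v \<cdot> k))"
proof -
  have "((\<lambda>x. x \<cdot> inverse k) has_derivative (\<lambda>h. h \<cdot> inverse k)) (at (v \<cdot> k))"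
    by (rule bounded_linear_imp_has_derivative[OF smult.bounded_linear_left])
  moreover have "((\<lambda>x. F (line x)) has_derivative lift_deriv F v) (at (v \<cdot> k \<cdot> inverse k))"
    using lift_has_derivative[OF d] by (simp add: smult_inverse[OF k])
  ultimately have "((\<lambda>x. F (line (x \<cdot> inverse k))) has_derivative
      (\<lambda>h. lift_deriv F v (h \<cdot> inverse k))) (at (v \<cdot> k))"
    by (rule has_derivative_compose)
  then show ?thesis using k by (simp add: line_smult)
qed

text \<open>
  The lift is constant on punctured lines, and \<open>v + \<epsilon> v k = v (1 + \<epsilon> k)\<close> stays on the line.
\<close>

lemma lift_deriv_along_line:
  assumes d: "(\<lambda>x. F (line x)) differentiable at v"
  shows "lift_deriv F v (v \<cdot> k) = 0"
proof -
  have "((\<lambda>\<epsilon>. v + \<epsilon> *\<^sub>R (v \<cdot> k)) has_derivative (\<lambda>\<epsilon>. \<epsilon> *\<^sub>R (v \<cdot> k))) (at 0)"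
    by (auto intro!: derivative_eq_intros)
  moreover have "((\<lambda>x. F (line x)) has_derivative lift_deriv F v) (at (v + 0 *\<^sub>R (v \<cdot> k)))"
    using lift_has_derivative[OF d] by simp
  ultimately have 1: "((\<lambda>\<epsilon>. F (line (v + \<epsilon> *\<^sub>R (v \<cdot> k)))) has_derivative
      (\<lambda>\<epsilon>. lift_deriv F v (\<epsilon> *\<^sub>R (v \<cdot> k)))) (at 0)"
    by (rule has_derivative_compose)
  have "continuous_on UNIV (\<lambda>\<epsilon>. 1 + \<epsilon> *\<^sub>R k)" by (intro continuous_intros)
  then have "open ((\<lambda>\<epsilon>. 1 + \<epsilon> *\<^sub>R k) -` (- {0}))" by (rule open_vimage[rotated]) auto
  moreover have "F (line (v + \<epsilon> *\<^sub>R (v \<cdot> k))) = F (line v)" if "1 + \<epsilon> *\<^sub>R k \<noteq> 0" for \<epsilon>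
  proof -
    have "v + \<epsilon> *\<^sub>R (v \<cdot> k) = v \<cdot> (1 + \<epsilon> *\<^sub>R k)"
      by (simp add: smult_add_right smult_one smult_scaleR_right)
    then show ?thesis using that by (simp add: line_smult)
  qed
  ultimately have "((\<lambda>\<epsilon>. F (line v)) has_derivative (\<lambda>\<epsilon>. lift_deriv F v (\<epsilon> *\<^sub>R (v \<cdot> k)))) (at 0)"
    by (intro has_derivative_transform_within_open[OF 1]) auto
  then have "(\<lambda>\<epsilon>. lift_deriv F v (\<epsilon> *\<^sub>R (v \<cdot> k))) = (\<lambda>\<epsilon>. 0)"
    by (rule has_derivative_unique) (rule has_derivative_const)
  then have "lift_deriv F v (1 *\<^sub>R (v \<cdot> k)) = 0" by (rule fun_cong)
  then show ?thesis by simp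
qed

lemma lift_deriv_coproj:
  assumes "v \<in> cone" and d: "(\<lambda>x. F (line x)) differentiable at v"
  shows "lift_deriv F v (coproj v w) = lift_deriv F v w"
proof -
  obtain k where "proj v w = v \<cdot> k" using proj_in_line by blast
  then show ?thesis
    using linear_diff[OF linear_lift_deriv[OF d], of w "proj v w"] lift_deriv_along_line[OF d, of k] by simp
qed

text \<open>
  The representative chosen in the definition of \<open>derivation\<close> is some \<open>v k\<close>. By the rescaling lemma
  the lift has the same derivative at \<open>v k\<close> along \<open>t (v k) = (t v) k\<close> as at \<open>v\<close> along \<open>t v\<close>.
\<close>

lemma derivation_line:
  assumes v: "v \<in> cone" and K: "K_linear t" and d: "(\<lambda>x. f (line x)) differentiable at v"
  shows "derivation (line v) t f = lift_deriv f v (t v)"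
proof -
  define w where "w = (SOME w. w \<in> line v \<and> w \<noteq> 0)"
  have "w \<in> line v \<and> w \<noteq> 0"
    unfolding w_def by (rule someI[of _ v]) (simp add: mem_line cone_nonzero[OF v])
  then obtain k where k: "k \<noteq> 0" "w = v \<cdot> k" by (auto elim: mem_line_nonzero)
  have "((\<lambda>\<epsilon>. w + \<epsilon> *\<^sub>R t w) has_derivative (\<lambda>\<epsilon>. \<epsilon> *\<^sub>R t w)) (at 0)"
    by (auto intro!: derivative_eq_intros)
  moreover have "((\<lambda>x. f (line x)) has_derivative (\<lambda>h. lift_deriv f v (h \<cdot> inverse k))) (at (w + 0 *\<^sub>R t w))"
    using lift_has_derivative_rescale[OF d k(1)] k(2) by simp
  ultimately have "((\<lambda>\<epsilon>. f (line (w + \<epsilon> *\<^sub>R t w))) has_derivative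
      (\<lambda>\<epsilon>. lift_deriv f v ((\<epsilon> *\<^sub>R t w) \<cdot> inverse k))) (at 0)"
    by (rule has_derivative_compose)
  moreover have "lift_deriv f v ((\<epsilon> *\<^sub>R t w) \<cdot> inverse k) = lift_deriv f v (t v) * \<epsilon>" for \<epsilon>
    by (simp add: k(2) K_linear_smult[OF K] smult_scaleR_left smult_inverse[OF k(1)]
        linear_scale[OF linear_lift_deriv[OF d]])
  ultimately have "((\<lambda>\<epsilon>. f (line (w + \<epsilon> *\<^sub>R t w))) has_real_derivative lift_deriv f v (t v)) (at 0)"
    by (simp add: has_field_derivative_def)
  then show ?thesis
    unfolding derivation_def Let_def w_def[symmetric] by (rule DERIV_imp_deriv)
qed

lemma vector_field_smooth: "vector_field X \<Longrightarrow> smooth_map X"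
  and vector_field_tangent: "vector_field X \<Longrightarrow> v \<in> cone \<Longrightarrow> X (line v) \<in> tangent (line v)"
  by (auto simp: vector_field_def line_in_nonisotropic)

lemma field_deriv_line:
  assumes "vector_field X" "v \<in> cone" "(\<lambda>x. f (line x)) differentiable at v"
  shows "field_deriv X f (line v) = lift_deriv f v (X (line v) v)"
  unfolding field_deriv_def
  by (intro derivation_line assms tangent_K_linear[OF assms(2)] vector_field_tangent)

lemma lift_deriv_field_has_derivative:
  fixes Y :: "'v set \<Rightarrow> 'v \<Rightarrow>\<^sub>L 'v"
  assumes F: "smooth_map F" and Y: "smooth_map Y" and v: "v \<in> cone"
  shows "((\<lambda>x. lift_deriv F x (Y (line x) x)) has_derivative
    (\<lambda>h. lift_deriv2 F v h (Y (line v) v)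
       + lift_deriv F v (Y (line v) h + lift_deriv Y v h v))) (at v)"
  unfolding lift_deriv2_def lift_deriv_def[of F]
proof (rule frechet_derivative_apply_has_derivative[OF open_cone v])
  show "Ck_on 2 cone (\<lambda>x. F (line x))" using F by (simp add: smooth_map_iff)
  show "((\<lambda>x. Y (line x) x) has_derivative (\<lambda>h. Y (line v) h + lift_deriv Y v h v)) (at v)"
    by (intro blinfun.FDERIV lift_has_derivative smooth_map_differentiable[OF Y v] has_derivative_ident)
qed

section \<open>The Levi-Civita connection\<close>

text \<open>
  The candidate connection: differentiate in the ambient space of linear maps, then project to the
  tangent space at \<open>line v\<close>.
\<close>

definition nabla :: "('v set \<Rightarrow> 'v \<Rightarrow>\<^sub>L 'v) \<Rightarrow> ('v set \<Rightarrow> 'v \<Rightarrow>\<^sub>L 'v) \<Rightarrow> 'v \<Rightarrow> 'v \<Rightarrow>\<^sub>L 'v" where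
  "nabla X Y v = coproj v o\<^sub>L lift_deriv Y v (X (line v) v) o\<^sub>L proj v"

lemma K_linear_lift_deriv:
  assumes Y: "vector_field Y" and v: "v \<in> cone"
  shows "K_linear (lift_deriv Y v h)"
  unfolding K_linear_def
proof (intro allI)
  fix w k
  have d: "((\<lambda>x. Y (line x) u) has_derivative (\<lambda>h. lift_deriv Y v h u)) (at v)" for u
    by (intro bounded_linear.has_derivative[OF blinfun.bounded_linear_left] lift_has_derivative
        smooth_map_differentiable vector_field_smooth Y v)
  show "lift_deriv Y v h (w \<cdot> k) = lift_deriv Y v h w \<cdot> k"
    by (rule cone_derivative_unique[OF v _ d bounded_linear.has_derivative[OF smult.bounded_linear_left d]])
      (simp add: K_linear_smult tangent_K_linear vector_field_tangent[OF Y])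
qed

lemma nabla_tangent:
  "vector_field Y \<Longrightarrow> v \<in> cone \<Longrightarrow> nabla X Y v \<in> tangent (line v)"
  unfolding nabla_def by (intro coproj_compose_tangent K_linear_lift_deriv)

text \<open>
  The tautological embedding of the space of points into the linear maps: it provides the test functions
  of \<open>tangent_eqI\<close> and the fields of \<open>tangent_extension\<close>.
\<close>

definition point_proj :: "'v set \<Rightarrow> ('v \<Rightarrow>\<^sub>L 'v)" where
  "point_proj p = proj (SOME v. v \<in> cone \<and> line v = p)"

lemma point_proj_line [simp]: "v \<in> cone \<Longrightarrow> point_proj (line v) = proj v"
proof -
  assume v: "v \<in> cone"
  define w where "w = (SOME w. w \<in> cone \<and> line w = line v)"
  have w: "w \<in> cone \<and> line w = line v" unfolding w_def by (rule someI[of _ v]) (simp add: v)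
  then have "w \<in> line v" using mem_line by blast
  then obtain k where "k \<noteq> 0" "w = v \<cdot> k"
    using w cone_nonzero by (metis mem_line_nonzero)
  then show ?thesis unfolding point_proj_def w_def[symmetric] by (simp add: proj_rescale[OF v])
qed

lemma Ck_on_point_proj: "Ck_on n cone (\<lambda>x. point_proj (line x))"
  by (rule Ck_on_cong[OF open_cone _ Ck_on_proj]) simp

text \<open>
  The matrix entries of the projection are smooth functions of the point. Their derivatives along
  \<open>t\<close> are the entries of \<open>t + t\<^sup>*\<close>, and \<open>(t + t\<^sup>*) P = t\<close>.
\<close>

lemma tangent_eqI:
  assumes v: "v \<in> cone" and t: "t \<in> tangent (line v)" "t' \<in> tangent (line v)"
    and eq: "\<And>f. smooth_map f \<Longrightarrow> derivation (line v) t f = derivation (line v) t' f"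
  shows "t = t'"
proof -
  have "frechet_derivative proj (at v) (t v) w \<bullet> b = frechet_derivative proj (at v) (t' v) w \<bullet> b" for w b
  proof -
    let ?L = "\<lambda>T :: 'v \<Rightarrow>\<^sub>L 'v. T w \<bullet> b" and ?f = "\<lambda>q. point_proj q w \<bullet> b"
    have L: "bounded_linear ?L" by (intro bounded_linear_intros)
    have f: "smooth_map ?f"
      using Ck_on_bounded_linear_comp[OF open_cone L Ck_on_point_proj] by (simp add: smooth_map_iff)
    have "((\<lambda>x. ?f (line x)) has_derivative (\<lambda>h. ?L (frechet_derivative proj (at v) h))) (at v)"
      by (rule has_derivative_transform_within_open[OF _ open_cone v])
        (auto intro!: bounded_linear.has_derivative[OF L] proj_has_derivative[OF v])
    then have "lift_deriv ?f v = (\<lambda>h. ?L (frechet_derivative proj (at v) h))" by (rule lift_deriv_eqI)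
    then show ?thesis
      using eq[OF f] by (simp add: derivation_line v t tangent_K_linear[OF v] smooth_map_differentiable[OF f])
  qed
  then have *: "t w + adj t w = t' w + adj t' w" for w
    by (auto simp: proj_derivative_tangent v t blinfun.add_left intro: euclidean_eqI)
  have "t w = t' w" for w
    using *[of "proj v w"] by (simp add: v t)
  then show ?thesis by (intro blinfun_eqI)
qed

text \<open>
  The term \<open>f'(v) (Y (X v))\<close> of the product rule vanishes, because \<open>X v\<close> is orthogonal to \<open>v\<close> and
  \<open>Y\<close> kills the orthogonal complement.
\<close>

lemma iterated_field_deriv:
  assumes f: "smooth_map (f :: 'v set \<Rightarrow> real)" and X: "vector_field X" and Y: "vector_field Y" and v: "v \<in> cone"
  shows "field_deriv X (field_deriv Y f) (line v)
    = lift_deriv2 f v (X (line v) v) (Y (line v) v) + lift_deriv f v (lift_deriv Y v (X (line v) v) v)"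
proof -
  have "((\<lambda>x. field_deriv Y f (line x)) has_derivative
    (\<lambda>h. lift_deriv2 f v h (Y (line v) v)
       + lift_deriv f v (Y (line v) h + lift_deriv Y v h v))) (at v)"
    by (rule has_derivative_transform_within_open[OF
          lift_deriv_field_has_derivative[OF f vector_field_smooth[OF Y] v] open_cone v])
      (simp add: field_deriv_line[OF Y] smooth_map_differentiable[OF f])
  then have "field_deriv X (field_deriv Y f) (line v) = lift_deriv2 f v (X (line v) v) (Y (line v) v)
       + lift_deriv f v (Y (line v) (X (line v) v) + lift_deriv Y v (X (line v) v) v)"
    by (subst field_deriv_line[OF X v]) (auto simp: differentiable_def lift_deriv_eqI)
  then show ?thesis
    by (simp add: tangent_tangent[OF v vector_field_tangent[OF X v] vector_field_tangent[OF Y v]])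
qed

lemma nabla_antisymmetrized_apply:
  assumes v: "v \<in> cone"
  shows "(nabla X Y v - nabla Y X v) v
    = coproj v (lift_deriv Y v (X (line v) v) v - lift_deriv X v (Y (line v) v) v)"
  using v by (simp add: nabla_def blinfun.diff_left blinfun.diff_right)

text \<open>
  This is torsion-freeness of \<open>nabla\<close>. The second derivatives of the test function cancel by
  Schwarz's theorem; the projection in \<open>nabla\<close> is invisible to functions of points.
\<close>

lemma lie_bracket_line:
  assumes X: "vector_field X" and Y: "vector_field Y" and v: "v \<in> cone"
  shows "lie_bracket X Y (line v) = nabla X Y v - nabla Y X v"
proof -
  let ?t = "nabla X Y v - nabla Y X v"
  have t: "?t \<in> tangent (line v)" by (intro tangent_diff nabla_tangent X Y v)
  have bracket: "derivation (line v) ?t f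
      = field_deriv X (field_deriv Y f) (line v) - field_deriv Y (field_deriv X f) (line v)"
    if f: "smooth_map f" for f
  proof -
    note d = smooth_map_differentiable[OF f v]
    have symmetric: "lift_deriv2 f v h k = lift_deriv2 f v k h" for h k
      unfolding lift_deriv2_def lift_deriv_def
      using second_derivative_symmetric_real[OF open_cone v] f by (simp add: smooth_map_iff)
    have "derivation (line v) ?t f
      = lift_deriv f v (coproj v (lift_deriv Y v (X (line v) v) v - lift_deriv X v (Y (line v) v) v))"
      unfolding derivation_line[OF v tangent_K_linear[OF v t] d] nabla_antisymmetrized_apply[OF v] ..
    also have "\<dots> = lift_deriv f v (lift_deriv Y v (X (line v) v) v) - lift_deriv f v (lift_deriv X v (Y (line v) v) v)"
      unfolding lift_deriv_coproj[OF v d] by (rule linear_diff[OF linear_lift_deriv[OF d]])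
    finally show ?thesis
      unfolding iterated_field_deriv[OF f X Y v] iterated_field_deriv[OF f Y X v]
      using symmetric[of "X (line v) v"] by simp
  qed
  show ?thesis
    unfolding lie_bracket_def
  proof (rule the_equality)
    show "?t \<in> tangent (line v) \<and> (\<forall>f. smooth_map f \<longrightarrow> derivation (line v) ?t f
        = field_deriv X (field_deriv Y f) (line v) - field_deriv Y (field_deriv X f) (line v))"
      using t bracket by blast
  qed (auto intro: tangent_eqI[OF v] simp: t bracket)
qed

lemma trace_form_has_derivative:
  assumes "(Y has_derivative Y') (at v)" "(Z has_derivative Z') (at v)"
  shows "((\<lambda>x. trace_form (Y x) (Z x)) has_derivative
    (\<lambda>h. trace_form (Y v) (Z' h) + trace_form (Y' h) (Z v))) (at v)"
proof -
  have "((\<lambda>x. trace_form (Y x) (Z x)) has_derivative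
    (\<lambda>h. \<Sum>b\<in>Basis. re_form (Y v (dual b)) (Z' h b) + re_form (Y' h (dual b)) (Z v b))) (at v)"
    unfolding trace_form_def
    by (intro has_derivative_sum re_form.FDERIV assms
        bounded_linear.has_derivative[OF blinfun.bounded_linear_left])
  then show ?thesis by (simp add: trace_form_def sum.distrib)
qed

lemma trace_form_diff_left: "trace_form (s - t) z = trace_form s z - trace_form t z"
  by (simp add: trace_form_def blinfun.diff_left re_form.diff_left sum_subtractf)

lemma trace_form_coproj_compose:
  assumes v: "v \<in> cone" and z: "z \<in> tangent (line v)"
  shows "trace_form (coproj v o\<^sub>L A o\<^sub>L proj v) z = trace_form A z"
proof -
  have P: "re_form (proj v u) w = re_form u (proj v w)" for u w by (simp add: re_form_def form_proj)
  then have Q: "re_form (coproj v u) w = re_form u (coproj v w)" for u w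
    by (simp add: re_form.diff_left re_form.diff_right)
  have "coproj v o\<^sub>L z = z" "z o\<^sub>L proj v = z" using v z by (auto intro: blinfun_eqI)
  then show ?thesis
    by (simp only: trace_form_compose_right[OF P] trace_form_compose_left[OF Q])
qed

text \<open>
  Differentiating the trace form gives ambient derivatives of the two fields. Pairing with a tangent
  map does not see the difference between an ambient derivative and its projection.
\<close>

lemma nabla_metric:
  assumes X: "vector_field X" and Y: "vector_field Y" and Z: "vector_field Z" and v: "v \<in> cone"
  shows "field_deriv X (\<lambda>q. metric \<sigma> (Y q) (Z q)) (line v)
    = metric \<sigma> (nabla X Y v) (Z (line v)) + metric \<sigma> (Y (line v)) (nabla X Z v)"
proof -
  let ?c = "\<sigma> / DIM('k)"
  have m: "metric \<sigma> t z = ?c * trace_form t z" if "x \<in> cone" "t \<in> tangent (line x)" for t z x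
    using metric_eq_trace_form[OF tangent_K_linear[OF that]] by simp
  have "((\<lambda>x. metric \<sigma> (Y (line x)) (Z (line x))) has_derivative
     (\<lambda>h. ?c * (trace_form (Y (line v)) (lift_deriv Z v h) + trace_form (lift_deriv Y v h) (Z (line v))))) (at v)"
  proof (rule has_derivative_transform_within_open[OF _ open_cone v])
    show "((\<lambda>x. ?c * trace_form (Y (line x)) (Z (line x))) has_derivative
     (\<lambda>h. ?c * (trace_form (Y (line v)) (lift_deriv Z v h) + trace_form (lift_deriv Y v h) (Z (line v))))) (at v)"
      by (intro has_derivative_mult_right trace_form_has_derivative lift_has_derivative
          smooth_map_differentiable vector_field_smooth Y Z v)
  qed (simp add: m[OF _ vector_field_tangent[OF Y]])
  then have "field_deriv X (\<lambda>q. metric \<sigma> (Y q) (Z q)) (line v)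
    = ?c * (trace_form (Y (line v)) (lift_deriv Z v (X (line v) v))
        + trace_form (lift_deriv Y v (X (line v) v)) (Z (line v)))"
    by (subst field_deriv_line[OF X v]) (auto simp: differentiable_def lift_deriv_eqI)
  also have "trace_form (lift_deriv Y v (X (line v) v)) (Z (line v)) = trace_form (nabla X Y v) (Z (line v))"
    by (simp add: nabla_def trace_form_coproj_compose[OF v vector_field_tangent[OF Z v]])
  also have "trace_form (Y (line v)) (lift_deriv Z v (X (line v) v)) = trace_form (Y (line v)) (nabla X Z v)"
    unfolding trace_form_commute[of "Y (line v)"]
    by (simp add: nabla_def trace_form_coproj_compose[OF v vector_field_tangent[OF Y v]])
  finally show ?thesis
    by (simp add: m[OF v] vector_field_tangent[OF Y v] nabla_tangent[OF Y v] distrib_left)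
qed

text \<open>
  The projection of the constant field \<open>t\<close> to each tangent space.
\<close>

lemma tangent_extension:
  assumes v: "v \<in> cone" and t: "t \<in> tangent (line v)"
  obtains T where "vector_field T" "T (line v) = t"
proof
  let ?T = "\<lambda>q. (id_blinfun - point_proj q) o\<^sub>L t o\<^sub>L point_proj q"
  have eq: "?T (line x) = coproj x o\<^sub>L t o\<^sub>L proj x" if "x \<in> cone" for x
    using that by (simp add: coproj_def)
  show "vector_field ?T"
    unfolding vector_field_def
  proof
    show "smooth_map ?T"
      unfolding smooth_map_iff
      by (intro allI Ck_on_bilinear[OF open_cone bounded_bilinear_blinfun_compose]
          Ck_on_diff[OF open_cone] Ck_on_point_proj Ck_on_const)
    show "\<forall>q\<in>nonisotropic_points. ?T q \<in> tangent q"
      using coproj_compose_tangent tangent_K_linear[OF v t] by (auto elim!: nonisotropic_pointE simp del: point_proj_line simp: eq)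
  qed
  show "?T (line v) = t" unfolding eq[OF v] by (rule coproj_tangent_proj[OF v t])
qed

text \<open>
  The difference \<open>A\<close> of two torsion-free metric connections is symmetric, while \<open>(A X Y, Z)\<close> is
  skew in \<open>Y\<close> and \<open>Z\<close>. Going round the three arguments gives \<open>(A X Y, Z) = - (A X Y, Z)\<close>.
\<close>

lemma levi_civita_unique:
  assumes lc: "levi_civita \<sigma> D" and \<sigma>: "\<sigma> \<noteq> 0"
    and X: "vector_field X" and Y: "vector_field Y" and v: "v \<in> cone"
  shows "D X Y (line v) = nabla X Y v"
proof -
  define A where "A X Y = D X Y (line v) - nabla X Y v" for X Y
  have p: "line v \<in> nonisotropic_points" using v by (rule line_in_nonisotropic)
  have D: "vector_field (D X Y)" if "vector_field X" "vector_field Y" for X Y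
    using lc that by (simp add: levi_civita_def affine_connection_def)
  have A_tangent: "A X Y \<in> tangent (line v)" if "vector_field X" "vector_field Y" for X Y
    unfolding A_def by (intro tangent_diff nabla_tangent vector_field_tangent D that v)
  have A_commute: "A X Y = A Y X" if "vector_field X" "vector_field Y" for X Y
  proof -
    have "D X Y (line v) - D Y X (line v) = lie_bracket X Y (line v)"
      using lc that p by (simp add: levi_civita_def torsion_free_def)
    then show ?thesis by (simp add: lie_bracket_line[OF that v] A_def algebra_simps)
  qed
  have A_skew: "trace_form (A X Y) (Z (line v)) = - trace_form (A X Z) (Y (line v))"
    if "vector_field X" "vector_field Y" "vector_field Z" for X Y Z
  proof -
    have "metric \<sigma> (D X Y (line v)) (Z (line v)) + metric \<sigma> (Y (line v)) (D X Z (line v))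
        = metric \<sigma> (nabla X Y v) (Z (line v)) + metric \<sigma> (Y (line v)) (nabla X Z v)"
      using lc that p nabla_metric[OF that v, of \<sigma>] by (simp add: levi_civita_def metric_compatible_def)
    then have "\<sigma> / DIM('k) * (trace_form (D X Y (line v)) (Z (line v)) + trace_form (Y (line v)) (D X Z (line v)))
      = \<sigma> / DIM('k) * (trace_form (nabla X Y v) (Z (line v)) + trace_form (Y (line v)) (nabla X Z v))"
      by (simp add: metric_eq_trace_form tangent_K_linear[OF v] vector_field_tangent[OF _ v] D
          nabla_tangent[OF _ v] that distrib_left)
    then have "trace_form (D X Y (line v)) (Z (line v)) + trace_form (Y (line v)) (D X Z (line v))
      = trace_form (nabla X Y v) (Z (line v)) + trace_form (Y (line v)) (nabla X Z v)"
      using \<sigma> by simp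
    then show ?thesis
      by (simp add: A_def trace_form_diff_left trace_form_commute[of "Y (line v)"])
  qed
  have "trace_form (A X Y) (Z (line v)) = 0" if Z: "vector_field Z" for Z
  proof -
    have "trace_form (A X Y) (Z (line v)) = - trace_form (A Z X) (Y (line v))"
      using A_skew[OF X Y Z] A_commute[OF X Z] by simp
    also have "\<dots> = trace_form (A Y Z) (X (line v))"
      using A_skew[OF Z X Y] A_commute[OF Z Y] by simp
    also have "\<dots> = - trace_form (A X Y) (Z (line v))"
      using A_skew[OF Y Z X] A_commute[OF Y X] by simp
    finally show ?thesis by simp
  qed
  then have "metric \<sigma> (A X Y) z = 0" if "z \<in> tangent (line v)" for z
    using tangent_extension[OF v that] metric_eq_trace_form[OF tangent_K_linear[OF v A_tangent[OF X Y]]]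
    by (metis mult_zero_right div_0)
  then have "A X Y = 0" by (rule metric_nondegenerate[OF v \<sigma> A_tangent[OF X Y]])
  then show ?thesis by (simp add: A_def)
qed

section \<open>The curvature\<close>

text \<open>
  The field \<open>E\<close> stands for \<open>\<nabla>\<^sub>T\<^sub>1 S\<close>; only its values on the cone matter, so the values of any connection
  that agrees with \<open>nabla\<close> there can be used.
\<close>

lemma nabla_nabla:
  assumes T1: "vector_field T1" and T2: "vector_field T2" and S: "vector_field S" and v: "v \<in> cone"
    and E: "\<And>x. x \<in> cone \<Longrightarrow> E (line x) = nabla T1 S x"
  defines "t1 \<equiv> T1 (line v)" and "t2 \<equiv> T2 (line v)" and "s \<equiv> S (line v)"
  shows "nabla T2 E v
    = (coproj v o\<^sub>L (lift_deriv2 S v (t2 v) (t1 v) + lift_deriv S v (lift_deriv T1 v (t2 v) v)) o\<^sub>L proj v)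
      + (s o\<^sub>L adj t1 o\<^sub>L t2) + (t2 o\<^sub>L adj t1 o\<^sub>L s)"
proof -
  note dS = lift_has_derivative[OF smooth_map_differentiable[OF vector_field_smooth[OF S] v]]
  have t: "t1 \<in> tangent (line v)" "t2 \<in> tangent (line v)" "s \<in> tangent (line v)"
    unfolding t1_def t2_def s_def by (intro vector_field_tangent T1 T2 S v)+
  let ?A = "lift_deriv S v (t1 v)"
  let ?A' = "lift_deriv2 S v (t2 v) (t1 v) + lift_deriv S v (lift_deriv T1 v (t2 v) v)"
  let ?P' = "frechet_derivative proj (at v)"
  note dP = proj_has_derivative[OF v]
  have P1: "?P' (t1 v) w = t1 w + adj t1 w" and P2: "?P' (t2 v) w = t2 w + adj t2 w" for w
    by (simp_all add: proj_derivative_tangent v t blinfun.add_left)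
  \<comment> \<open>Differentiate \<open>S P = S\<close> along \<open>t1 v\<close> and apply the result to \<open>t2 w\<close>, which \<open>P\<close> and \<open>s t1\<close> kill.\<close>
  have "?A (t2 w) = s (adj t1 (t2 w))" for w
  proof -
    have "s (?P' (t1 v) u) + ?A (proj v u) = ?A u" for u
      unfolding s_def
      by (rule cone_derivative_unique[OF v _ blinfun.FDERIV[OF dS
              bounded_linear.has_derivative[OF blinfun.bounded_linear_left dP]]
            bounded_linear.has_derivative[OF blinfun.bounded_linear_left dS]])
        (simp add: vector_field_tangent[OF S])
    from this[of "t2 w"] show ?thesis
      by (simp add: P1 v t tangent_tangent[OF v t(1,3)] blinfun.add_right)
  qed
  \<comment> \<open>Differentiate \<open>P S = 0\<close> along \<open>t1 v\<close>; since \<open>t2 = t2 P\<close>, only the component along \<open>v\<close> counts.\<close>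
  moreover have "t2 (?A w) = - t2 (adj t1 (s w))" for w
  proof -
    have "proj v (?A w) + ?P' (t1 v) (s w) = 0"
      unfolding s_def
      by (rule cone_derivative_unique[OF v _ blinfun.FDERIV[OF dP
              bounded_linear.has_derivative[OF blinfun.bounded_linear_left dS]]
            has_derivative_const])
        (simp add: vector_field_tangent[OF S])
    then have "proj v (?A w) = - adj t1 (s w)"
      by (simp add: P1 tangent_tangent[OF v t(3,1)] eq_neg_iff_add_eq_0)
    then have "t2 (proj v (?A w)) = - t2 (adj t1 (s w))" by (simp add: blinfun.minus_right)
    then show ?thesis using v t by simp
  qed
  moreover have "lift_deriv E v (t2 v) = (coproj v o\<^sub>L ?A o\<^sub>L ?P' (t2 v))
      + (((coproj v o\<^sub>L ?A') + ((0 - ?P' (t2 v)) o\<^sub>L ?A)) o\<^sub>L proj v)"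
  proof -
    let ?dA = "\<lambda>h. lift_deriv2 S v h (t1 v) + lift_deriv S v (t1 h + lift_deriv T1 v h v)"
    have dA: "((\<lambda>x. lift_deriv S x (T1 (line x) x)) has_derivative ?dA) (at v)"
      unfolding t1_def by (intro lift_deriv_field_has_derivative vector_field_smooth S T1 v)
    have dQ: "(coproj has_derivative (\<lambda>h. 0 - ?P' h)) (at v)"
      unfolding coproj_def[abs_def] by (intro has_derivative_diff has_derivative_const dP)
    have "((\<lambda>x. E (line x)) has_derivative (\<lambda>h. (coproj v o\<^sub>L lift_deriv S v (T1 (line v) v) o\<^sub>L ?P' h)
        + (((coproj v o\<^sub>L ?dA h) + ((0 - ?P' h) o\<^sub>L lift_deriv S v (T1 (line v) v))) o\<^sub>L proj v))) (at v)"
      by (rule has_derivative_transform_within_open[OF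
            bounded_bilinear.FDERIV[OF bounded_bilinear_blinfun_compose
              bounded_bilinear.FDERIV[OF bounded_bilinear_blinfun_compose dQ dA] dP] open_cone v])
        (simp add: E nabla_def)
    from lift_deriv_eqI[OF this] show ?thesis
      by (simp add: tangent_tangent[OF v t(2,1)] flip: t1_def)
  qed
  ultimately show ?thesis
    by (intro blinfun_eqI)
      (simp add: nabla_def P2 v t blinfun.minus_left blinfun.add_left blinfun.add_right blinfun.diff_left blinfun.diff_right
        flip: t2_def)
qed

text \<open>
  By uniqueness the given connection may be replaced by \<open>nabla\<close> throughout. For this the bracket must be
  a smooth field, which is inherited from \<open>D T1 T2 - D T2 T1\<close>.
\<close>

lemma curvature_field_line:
  assumes lc: "levi_civita \<sigma> D" and \<sigma>: "\<sigma> \<noteq> 0"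
    and T1: "vector_field T1" and T2: "vector_field T2" and S: "vector_field S" and v: "v \<in> cone"
  defines "t1 \<equiv> T1 (line v)" and "t2 \<equiv> T2 (line v)" and "s \<equiv> S (line v)"
  shows "curvature_field D T1 T2 S (line v)
    = (s o\<^sub>L adj t1 o\<^sub>L t2) + (t2 o\<^sub>L adj t1 o\<^sub>L s) - (s o\<^sub>L adj t2 o\<^sub>L t1) - (t1 o\<^sub>L adj t2 o\<^sub>L s)"
proof -
  note D_eq = levi_civita_unique[OF lc \<sigma>]
  have D: "vector_field (D X Y)" if "vector_field X" "vector_field Y" for X Y
    using lc that by (simp add: levi_civita_def affine_connection_def)
  have bracket: "vector_field (lie_bracket T1 T2)"
    unfolding vector_field_def
  proof
    show "smooth_map (lie_bracket T1 T2)"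
    proof (rule smooth_map_cong)
      show "smooth_map (\<lambda>q. D T1 T2 q - D T2 T1 q)"
        using vector_field_smooth[OF D[OF T1 T2]] vector_field_smooth[OF D[OF T2 T1]]
        unfolding smooth_map_iff by (auto intro: Ck_on_diff[OF open_cone])
      show "D T1 T2 q - D T2 T1 q = lie_bracket T1 T2 q" if "q \<in> nonisotropic_points" for q
        using lc T1 T2 that by (simp add: levi_civita_def torsion_free_def)
    qed
    show "\<forall>q\<in>nonisotropic_points. lie_bracket T1 T2 q \<in> tangent q"
      by (auto elim!: nonisotropic_pointE simp: lie_bracket_line T1 T2 intro!: tangent_diff nabla_tangent)
  qed
  let ?d = "lift_deriv S v" and ?a = "lift_deriv T1 v (t2 v) v" and ?b = "lift_deriv T2 v (t1 v) v"
  note dS = smooth_map_differentiable[OF vector_field_smooth[OF S] v]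
  have 1: "D T2 (D T1 S) (line v) = (coproj v o\<^sub>L (lift_deriv2 S v (t2 v) (t1 v) + ?d ?a) o\<^sub>L proj v)
      + (s o\<^sub>L adj t1 o\<^sub>L t2) + (t2 o\<^sub>L adj t1 o\<^sub>L s)"
    unfolding D_eq[OF T2 D[OF T1 S] v] t1_def t2_def s_def
    by (rule nabla_nabla[OF T1 T2 S v]) (rule D_eq[OF T1 S])
  have 2: "D T1 (D T2 S) (line v) = (coproj v o\<^sub>L (lift_deriv2 S v (t1 v) (t2 v) + ?d ?b) o\<^sub>L proj v)
      + (s o\<^sub>L adj t2 o\<^sub>L t1) + (t1 o\<^sub>L adj t2 o\<^sub>L s)"
    unfolding D_eq[OF T1 D[OF T2 S] v] t1_def t2_def s_def
    by (rule nabla_nabla[OF T2 T1 S v]) (rule D_eq[OF T2 S])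
  have symmetric: "lift_deriv2 S v (t2 v) (t1 v) = lift_deriv2 S v (t1 v) (t2 v)"
    unfolding lift_deriv2_def lift_deriv_def
    by (rule second_derivative_symmetric_blinfun[OF open_cone v])
      (use vector_field_smooth[OF S] in \<open>simp add: smooth_map_iff\<close>)
  have "lie_bracket T1 T2 (line v) v = coproj v (?b - ?a)"
    unfolding lie_bracket_line[OF T1 T2 v] nabla_antisymmetrized_apply[OF v] t1_def t2_def ..
  then have "?d (lie_bracket T1 T2 (line v) v) = ?d ?b - ?d ?a"
    using lift_deriv_coproj[OF v dS] linear_diff[OF linear_lift_deriv[OF dS]] by metis
  then have 3: "D (lie_bracket T1 T2) S (line v) = coproj v o\<^sub>L (?d ?b - ?d ?a) o\<^sub>L proj v"
    by (simp add: D_eq[OF bracket S v] nabla_def)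
  show ?thesis
    unfolding curvature_field_def 1 2 3 symmetric
    by (rule blinfun_eqI)
      (simp add: blinfun.add_left blinfun.diff_left blinfun.add_right blinfun.diff_right)
qed

end

theorem mainTheorem4:
  fixes smult :: "'v::euclidean_space \<Rightarrow> 'k::rch_algebra \<Rightarrow> 'v"
    and form :: "'v \<Rightarrow> 'v \<Rightarrow> 'k"
    and \<sigma> :: real
    and D :: "('v set \<Rightarrow> 'v \<Rightarrow>\<^sub>L 'v) \<Rightarrow> ('v set \<Rightarrow> 'v \<Rightarrow>\<^sub>L 'v) \<Rightarrow> ('v set \<Rightarrow> 'v \<Rightarrow>\<^sub>L 'v)"
    and p :: "'v set"
    and t1 t2 s :: "'v \<Rightarrow>\<^sub>L 'v"
  assumes "hermitian_space smult form"
    and "\<sigma> \<in> {1, -1}"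
    and "hermitian_space.levi_civita smult form \<sigma> D"
    and "p \<in> hermitian_space.nonisotropic_points smult form"
    and "t1 \<in> hermitian_space.tangent smult form p"
    and "t2 \<in> hermitian_space.tangent smult form p"
    and "s \<in> hermitian_space.tangent smult form p"
  shows "hermitian_space.curvature_tensor smult form D p t1 t2 s =
      (s o\<^sub>L hermitian_space.adj form t1 o\<^sub>L t2)
    + (t2 o\<^sub>L hermitian_space.adj form t1 o\<^sub>L s)
    - (s o\<^sub>L hermitian_space.adj form t2 o\<^sub>L t1)
    - (t1 o\<^sub>L hermitian_space.adj form t2 o\<^sub>L s)"
proof -
  interpret hermitian_space smult form by fact
  let ?R = "(s o\<^sub>L adj t1 o\<^sub>L t2) + (t2 o\<^sub>L adj t1 o\<^sub>L s) - (s o\<^sub>L adj t2 o\<^sub>L t1) - (t1 o\<^sub>L adj t2 o\<^sub>L s)"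
  have \<sigma>: "\<sigma> \<noteq> 0" using assms(2) by auto
  obtain v where v: "v \<in> cone" and p: "p = line v"
    using assms(4) by (rule nonisotropic_pointE)
  have curvature: "curvature_field D T1 T2 S p = ?R"
    if "vector_field T1 \<and> vector_field T2 \<and> vector_field S \<and> T1 p = t1 \<and> T2 p = t2 \<and> S p = s"
    for T1 T2 S
    using curvature_field_line[OF assms(3) \<sigma>, of T1 T2 S v] that v p by simp
  obtain T1 T2 S where "vector_field T1" "T1 p = t1" "vector_field T2" "T2 p = t2" "vector_field S" "S p = s"
    using tangent_extension[OF v] assms(5-7) unfolding p by metis
  then show ?thesis
    unfolding curvature_tensor_def
    by (intro the_equality) (use curvature in \<open>blast, metis\<close>)
qed

end
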